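(* Let $\mathcal{F}\subseteq[\omega]^{<\omega}$ be a cover of $\omega$. Then the following are equivalent: (1) $\mathcal{F}$ is precompact; (2) $X_{\mathcal{F}}$ is $c_0$-saturated; (3) $X_{\mathcal{F}}$ does not contain an isomorphic copy of $\ell_1$, i.e. $(e_n)$ is a shrinking basis of $X_{\mathcal{F}}$; (4) no non-trivial $\mathcal{F}$-ideal is $F_\sigma$.
   Context: $[\omega]^{<\omega}$ is the set of finite subsets of $\omega$; $\mathcal{P}(\omega)$ is identified with $2^\omega$. $\mathcal{F}$ is precompact if its closure $\overline{\mathcal{F}}$ in $\mathcal{P}(\omega)$ consists only of finite sets. For $x\in\mathbb{R}^\omega$ let $\Phi_{\mathcal{F}}(x)=\sup\{\sum_{i\in F}|x_i|\colon F\in\mathcal{F}\}\in[0,\infty]$, and for $A\subseteq\omega$ let $P_A(x)(n)=x(n)$ if $n\in A$ and $0$ otherwise. $X_{\mathcal{F}}=\{x\in\mathbb{R}^\omega\colon\lim_{n\to\infty}\Phi_{\mathcal{F}}(P_{\omega\setminus n}(x))=0\}$, a Banach space with norm $\Phi_{\mathcal{F}}$, in which the unit vectors $(e_n)$ form an unconditional basis. A Banach space $X$ is $c_0$-saturated if every infinite-dimensional closed subspace contains an isomorphic copy of $c_0$. For $\tau\in(0,\infty)^\omega$ let $\varphi_{\mathcal{F},\tau}(A)=\Phi_{\mathcal{F}}(P_A(\tau))$ and $\mathcal{I}_{\mathcal{F},\tau}=\{A\subseteq\omega\colon\lim_n\varphi_{\mathcal{F},\tau}(A\setminus n)=0\}$;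 ideals of this form are called $\mathcal{F}$-ideals. An $\mathcal{F}$-ideal is non-trivial if it is not a trivial modification of $\mathrm{Fin}$, i.e. not of the form $\{A\subseteq\omega\colon|A\cap X|<\omega\}$ for any $X\subseteq\omega$. $F_\sigma$ refers to the topology of $\mathcal{P}(\omega)\cong2^\omega$. *)

theory Defs
  imports "HOL-Analysis.Analysis" "HOL-Library.Function_Algebras"
begin

text \<open>Real sequences form a real vector space under the pointwise operations; this makes the
  library notions \<open>subspace\<close> and \<open>span\<close> available for them.\<close>

instantiation "fun" :: (type, real_vector) real_vector
begin

definition scaleR_fun_def: "c *\<^sub>R f = (\<lambda>x. c *\<^sub>R f x)"

instance
  by standard (simp_all add: scaleR_fun_def fun_eq_iff scaleR_add_right scaleR_add_left)

end


section \<open>Normed spaces carried by a subspace\<close>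

text \<open>The space under study depends on a family of sets, so it cannot be a type. A normed space is
  represented by a linear subspace \<open>X\<close> of an ambient real vector space together with a function
  \<open>N\<close> that is a norm on \<open>X\<close>; values of \<open>N\<close> outside \<open>X\<close> are irrelevant.\<close>

definition norm_topology :: "'a::real_vector set \<Rightarrow> ('a \<Rightarrow> real) \<Rightarrow> 'a topology" where
  "norm_topology X N = Metric_space.mtopology X (\<lambda>x y. N (x - y))"

definition linear_on_set :: "'a::real_vector set \<Rightarrow> ('a \<Rightarrow> 'b::real_vector) \<Rightarrow> bool" where
  "linear_on_set X T \<longleftrightarrow>
     (\<forall>x\<in>X. \<forall>y\<in>X. T (x + y) = T x + T y) \<and> (\<forall>c. \<forall>x\<in>X. T (c *\<^sub>R x) = c *\<^sub>R T x)"

definition bounded_linear_on_set ::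
  "'a::real_vector set \<Rightarrow> ('a \<Rightarrow> real) \<Rightarrow> ('b::real_vector \<Rightarrow> real) \<Rightarrow> ('a \<Rightarrow> 'b) \<Rightarrow> bool" where
  "bounded_linear_on_set X N M T \<longleftrightarrow>
     linear_on_set X T \<and> (\<exists>C. \<forall>x\<in>X. M (T x) \<le> C * N x)"

definition isomorphism ::
  "'a::real_vector set \<Rightarrow> ('a \<Rightarrow> real) \<Rightarrow> 'b::real_vector set \<Rightarrow> ('b \<Rightarrow> real) \<Rightarrow> ('a \<Rightarrow> 'b) \<Rightarrow> bool" where
  "isomorphism X N Y M T \<longleftrightarrow>
     bij_betw T X Y \<and> bounded_linear_on_set X N M T \<and>
     bounded_linear_on_set Y M N (inv_into X T)"

definition contains_copy ::
  "'a::real_vector set \<Rightarrow> ('a \<Rightarrow> real) \<Rightarrow> 'b::real_vector set \<Rightarrow> ('b \<Rightarrow> real) \<Rightarrow> bool" where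
  "contains_copy X N Z M \<longleftrightarrow>
     (\<exists>W T. subspace W \<and> W \<subseteq> X \<and> isomorphism Z M W N T)"

definition infinite_dimensional :: "'a::real_vector set \<Rightarrow> bool" where
  "infinite_dimensional Y \<longleftrightarrow> \<not> (\<exists>B. finite B \<and> Y \<subseteq> span B)"

definition schauder_basis ::
  "'a::real_vector set \<Rightarrow> ('a \<Rightarrow> real) \<Rightarrow> (nat \<Rightarrow> 'a) \<Rightarrow> bool" where
  "schauder_basis X N b \<longleftrightarrow>
     range b \<subseteq> X \<and>
     (\<forall>x\<in>X. \<exists>!a :: nat \<Rightarrow> real. (\<lambda>n. N (x - (\<Sum>k<n. a k *\<^sub>R b k))) \<longlonglongrightarrow> 0)"

definition closed_span ::
  "'a::real_vector set \<Rightarrow> ('a \<Rightarrow> real) \<Rightarrow> 'a set \<Rightarrow> 'a set" where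
  "closed_span X N B = norm_topology X N closure_of (span B)"

definition functional_norm :: "'a set \<Rightarrow> ('a \<Rightarrow> real) \<Rightarrow> ('a \<Rightarrow> real) \<Rightarrow> real" where
  "functional_norm Y N f = (SUP x\<in>{x\<in>Y. N x \<le> 1}. \<bar>f x\<bar>)"

text \<open>A basis is shrinking if the restrictions of every continuous linear functional to the closed
  spans of the tails of the basis tend to zero in norm.\<close>

definition shrinking_basis ::
  "'a::real_vector set \<Rightarrow> ('a \<Rightarrow> real) \<Rightarrow> (nat \<Rightarrow> 'a) \<Rightarrow> bool" where
  "shrinking_basis X N b \<longleftrightarrow>
     schauder_basis X N b \<and>
     (\<forall>f. bounded_linear_on_set X N (\<lambda>r::real. \<bar>r\<bar>) f \<longrightarrow>
        (\<lambda>n. functional_norm (closed_span X N (b ` {n..})) N f) \<longlonglongrightarrow> 0)"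


section \<open>The classical sequence spaces\<close>

definition c0_space :: "(nat \<Rightarrow> real) set" where
  "c0_space = {x. x \<longlonglongrightarrow> 0}"

definition c0_norm :: "(nat \<Rightarrow> real) \<Rightarrow> real" where
  "c0_norm x = (SUP n. \<bar>x n\<bar>)"

definition l1_space :: "(nat \<Rightarrow> real) set" where
  "l1_space = {x. summable (\<lambda>n. \<bar>x n\<bar>)}"

definition l1_norm :: "(nat \<Rightarrow> real) \<Rightarrow> real" where
  "l1_norm x = (\<Sum>n. \<bar>x n\<bar>)"

definition c0_saturated :: "'a::real_vector set \<Rightarrow> ('a \<Rightarrow> real) \<Rightarrow> bool" where
  "c0_saturated X N \<longleftrightarrow>
     (\<forall>Y. subspace Y \<and> Y \<subseteq> X \<and> closedin (norm_topology X N) Y \<and> infinite_dimensional Y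
        \<longrightarrow> contains_copy Y N c0_space c0_norm)"


section \<open>The power set of \<open>\<omega>\<close> as a topological space\<close>

text \<open>Sets of natural numbers are identified with their characteristic functions in
  \<open>nat \<Rightarrow> bool\<close>, which carries the product of the discrete topologies.\<close>

definition chi :: "nat set \<Rightarrow> nat \<Rightarrow> bool" where
  "chi A = (\<lambda>n. n \<in> A)"

definition precompact_family :: "nat set set \<Rightarrow> bool" where
  "precompact_family \<F> \<longleftrightarrow> (\<forall>A. chi A \<in> closure (chi ` \<F>) \<longrightarrow> finite A)"

definition F_sigma :: "nat set set \<Rightarrow> bool" where
  "F_sigma \<I> \<longleftrightarrow> fsigma_in (euclidean :: (nat \<Rightarrow> bool) topology) (chi ` \<I>)"


section \<open>The Banach space and the ideals generated by a family\<close>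

definition Phi :: "nat set set \<Rightarrow> (nat \<Rightarrow> real) \<Rightarrow> ennreal" where
  "Phi \<F> x = (SUP F\<in>\<F>. ennreal (\<Sum>i\<in>F. \<bar>x i\<bar>))"

definition coord_proj :: "nat set \<Rightarrow> (nat \<Rightarrow> real) \<Rightarrow> nat \<Rightarrow> real" where
  "coord_proj A x = (\<lambda>n. if n \<in> A then x n else 0)"

definition X_space :: "nat set set \<Rightarrow> (nat \<Rightarrow> real) set" where
  "X_space \<F> = {x. (\<lambda>n. Phi \<F> (coord_proj (UNIV - {..<n}) x)) \<longlonglongrightarrow> 0}"

text \<open>On \<open>X_space \<F>\<close> the value of \<open>Phi \<F>\<close> is finite, because it is at most a finite
  sum of \<open>\<bar>x i\<bar>\<close> plus the value at a tail; so the conversion to a real number is harmless.\<close>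

definition X_norm :: "nat set set \<Rightarrow> (nat \<Rightarrow> real) \<Rightarrow> real" where
  "X_norm \<F> x = enn2real (Phi \<F> x)"

definition unit_vec :: "nat \<Rightarrow> nat \<Rightarrow> real" where
  "unit_vec n = (\<lambda>k. if k = n then 1 else 0)"

definition submeasure :: "nat set set \<Rightarrow> (nat \<Rightarrow> real) \<Rightarrow> nat set \<Rightarrow> ennreal" where
  "submeasure \<F> \<tau> A = Phi \<F> (coord_proj A \<tau>)"

definition family_ideal :: "nat set set \<Rightarrow> (nat \<Rightarrow> real) \<Rightarrow> nat set set" where
  "family_ideal \<F> \<tau> = {A. (\<lambda>n. submeasure \<F> \<tau> (A - {..<n})) \<longlonglongrightarrow> 0}"

definition is_family_ideal :: "nat set set \<Rightarrow> nat set set \<Rightarrow> bool" where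
  "is_family_ideal \<F> \<I> \<longleftrightarrow> (\<exists>\<tau>. (\<forall>n. \<tau> n > 0) \<and> \<I> = family_ideal \<F> \<tau>)"

definition trivial_modification_of_Fin :: "nat set set \<Rightarrow> bool" where
  "trivial_modification_of_Fin \<I> \<longleftrightarrow> (\<exists>X. \<I> = {A. finite (A \<inter> X)})"

end

theory Submission
  imports Defs "HOL-Library.Nat_Bijection"
begin

text \<open>If \<open>\<F>\<close> is precompact, the supremum defining the norm of an element of \<open>X_space \<F>\<close> is attained,
  after closing \<open>\<F>\<close>, at a finite set. Replace the constraint \<open>\<Phi> \<le> r\<close> by the strict constraints
  \<open>\<Sum>i\<in>E. \<bar>x i\<bar> \<le> c E\<close> for finite sets \<open>E\<close> contained in members of \<open>\<F>\<close>, where \<open>c E < r\<close> tends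
  to \<open>r\<close> along an enumeration of the finite sets. A sequence that satisfies them and lies in \<open>X_space \<F>\<close> has
  norm below \<open>r\<close>, so it can still be enlarged far out; hence a greedily chosen maximal one is
  bounded but lies outside \<open>X_space \<F>\<close>. Applied to the coefficients of a block sequence, this gives copies of
  \<open>c\<^sub>0\<close> in every infinite-dimensional closed subspace and shows that the basis is shrinking; applied
  to characteristic functions, it gives arbitrarily small sets outside a non-trivial ideal, which by
  a Baire category argument is then not \<open>F\<^sub>\<sigma>\<close>. Since \<open>\<ell>\<^sub>1\<close> has no sequence equivalent to the basis
  of \<open>c\<^sub>0\<close>, there is no copy of \<open>\<ell>\<^sub>1\<close> either.

  Conversely, an infinite set \<open>A\<close> in the closure of \<open>\<F>\<close> has all its initial segments covered by
  members of \<open>\<F>\<close>, so the norm restricted to \<open>A\<close> is the \<open>\<ell>\<^sub>1\<close> norm, and harmonic weights on \<open>A\<close>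
  give a summable ideal.\<close>

section \<open>The space of a family of finite sets\<close>

text \<open>The plain constraint fails because a tight finite set can block everything far out: for
  the family of all \<open>{0, n}\<close> with \<open>n > 0\<close> and \<open>r = 1\<close>, a
  greedy choice against the norm alone takes coordinate 0 equal to 1 and all others 0, a maximal
  sequence inside the space. Strict bounds tending to \<open>r\<close> prevent this: no set is ever
  filled up to \<open>r\<close>, while only finitely many sets keep a bound well below
  \<open>r\<close>. The constraints range over all subsets of members because a limit of members
  need not be a member; if finite, it is contained in one and so is controlled as well. The
  multipliers run over a closed set \<open>D\<close>, all nonnegative reals for vectors and {0, 1}
  for sets, so that one construction serves both. Each property is compared with precompactness
  directly, and copies of c0 are handled through estimates on finite sums, which pass along
  isomorphisms in both directions.\<close>

lemma scaleR_apply [simp]: "(c *\<^sub>R x) i = c *\<^sub>R x i"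
  by (simp add: scaleR_fun_def)

lemma sum_apply: "(\<Sum>k\<in>A. f k) i = (\<Sum>k\<in>A. f k i)"
  by (induction A rule: infinite_finite_induct) simp_all

lemma coord_proj_apply [simp]: "coord_proj A x i = (if i \<in> A then x i else 0)"
  by (simp add: coord_proj_def)

abbreviation asum :: "nat set \<Rightarrow> (nat \<Rightarrow> real) \<Rightarrow> real" where
  "asum E x \<equiv> \<Sum>i\<in>E. \<bar>x i\<bar>"

lemma asum_coord_proj: "finite E \<Longrightarrow> asum E (coord_proj A x) = asum (E \<inter> A) x"
  by (simp add: sum.inter_restrict if_distrib cong: if_cong)

lemma Phi_le_iff: "0 \<le> C \<Longrightarrow> Phi \<F> x \<le> ennreal C \<longleftrightarrow> (\<forall>F\<in>\<F>. asum F x \<le> C)"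
  by (simp add: Phi_def SUP_le_iff ennreal_le_iff)

lemma sum_unit_vec: "(\<Sum>k<n. a k *\<^sub>R unit_vec k) = coord_proj {..<n} a"
  by (rule ext) (simp add: sum_apply unit_vec_def if_distrib cong: if_cong)

locale cover_family =
  fixes \<F> :: "nat set set"
  assumes finite_members: "\<And>F. F \<in> \<F> \<Longrightarrow> finite F"
    and cover: "\<Union>\<F> = (UNIV :: nat set)"
begin

abbreviation X :: "(nat \<Rightarrow> real) set" where "X \<equiv> X_space \<F>"

abbreviation nrm :: "(nat \<Rightarrow> real) \<Rightarrow> real" where "nrm \<equiv> X_norm \<F>"

text \<open>Tails decrease in \<open>n\<close>, so one \<open>n\<close> for each
  \<open>\<epsilon>\<close> is enough. In this form membership is a statement about finite real
  sums, and the extended values of \<open>Phi\<close> can be left behind.\<close>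

lemma X_iff: "x \<in> X \<longleftrightarrow> (\<forall>\<epsilon>>0. \<exists>n. \<forall>F\<in>\<F>. asum (F - {..<n}) x \<le> \<epsilon>)"
proof -
  have tail: "Phi \<F> (coord_proj (UNIV - {..<n}) x) \<le> ennreal \<epsilon> \<longleftrightarrow>
      (\<forall>F\<in>\<F>. asum (F - {..<n}) x \<le> \<epsilon>)" if "\<epsilon> > 0" for \<epsilon> n
  proof -
    have "F \<inter> (UNIV - {..<n}) = F - {..<n}" for F by auto
    then show ?thesis
      using that by (simp add: Phi_le_iff asum_coord_proj finite_members del: coord_proj_apply)
  qed
  show ?thesis
  proof
    assume "x \<in> X"
    then have lim: "(\<lambda>n. Phi \<F> (coord_proj (UNIV - {..<n}) x)) \<longlonglongrightarrow> 0"
      by (simp add: X_space_def)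
    show "\<forall>\<epsilon>>0. \<exists>n. \<forall>F\<in>\<F>. asum (F - {..<n}) x \<le> \<epsilon>"
    proof (intro allI impI)
      fix \<epsilon> :: real assume "\<epsilon> > 0"
      then have "\<forall>\<^sub>F n in sequentially. Phi \<F> (coord_proj (UNIV - {..<n}) x) < ennreal \<epsilon>"
        using order_tendstoD(2)[OF lim, of "ennreal \<epsilon>"] by simp
      then obtain n where "Phi \<F> (coord_proj (UNIV - {..<n}) x) < ennreal \<epsilon>"
        using eventually_happens'[OF sequentially_bot] by blast
      then show "\<exists>n. \<forall>F\<in>\<F>. asum (F - {..<n}) x \<le> \<epsilon>"
        using tail[OF \<open>\<epsilon> > 0\<close>] less_imp_le by blast
    qed
  next
    assume *: "\<forall>\<epsilon>>0. \<exists>n. \<forall>F\<in>\<F>. asum (F - {..<n}) x \<le> \<epsilon>"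
    have "(\<lambda>n. Phi \<F> (coord_proj (UNIV - {..<n}) x)) \<longlonglongrightarrow> 0"
    proof (rule order_tendstoI)
      fix e :: ennreal assume "0 < e"
      then obtain z where z: "0 < z" "z < e" using dense by blast
      then obtain \<epsilon> where \<epsilon>: "z = ennreal \<epsilon>" "\<epsilon> > 0"
        by (metis ennreal_cases ennreal_less_zero_iff not_less_iff_gr_or_eq top.not_eq_extremum top_greatest not_le)
      obtain n where n: "\<forall>F\<in>\<F>. asum (F - {..<n}) x \<le> \<epsilon>" using * \<epsilon>(2) by blast
      have "Phi \<F> (coord_proj (UNIV - {..<m}) x) < e" if "m \<ge> n" for m
      proof -
        have "asum (F - {..<m}) x \<le> \<epsilon>" if "F \<in> \<F>" for F
        proof -
          have "asum (F - {..<m}) x \<le> asum (F - {..<n}) x"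
            using finite_members[OF \<open>F \<in> \<F>\<close>] \<open>m \<ge> n\<close> by (intro sum_mono2) auto
          with n \<open>F \<in> \<F>\<close> show ?thesis by fastforce
        qed
        then show ?thesis using tail[OF \<epsilon>(2), of m] \<epsilon>(1) z(2) by (auto dest: le_less_trans)
      qed
      then show "\<forall>\<^sub>F n in sequentially. Phi \<F> (coord_proj (UNIV - {..<n}) x) < e"
        by (auto simp: eventually_sequentially)
    qed simp
    then show "x \<in> X" by (simp add: X_space_def)
  qed
qed

lemma X_bounded:
  assumes "x \<in> X"
  obtains C where "0 \<le> C" "\<And>F. F \<in> \<F> \<Longrightarrow> asum F x \<le> C"
proof -
  obtain n where n: "\<forall>F\<in>\<F>. asum (F - {..<n}) x \<le> 1"
    using assms X_iff zero_less_one by blast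
  show thesis
  proof
    show "0 \<le> asum {..<n} x + 1" by (simp add: sum_nonneg add_nonneg_nonneg)
    fix F assume F: "F \<in> \<F>"
    have "asum F x = asum (F \<inter> {..<n}) x + asum (F - {..<n}) x"
      using finite_members[OF F] by (simp add: sum.Int_Diff)
    also have "\<dots> \<le> asum {..<n} x + 1"
      using n F by (intro add_mono sum_mono2) auto
    finally show "asum F x \<le> asum {..<n} x + 1" .
  qed
qed

lemma asum_le_norm:
  assumes "x \<in> X" "F \<in> \<F>"
  shows "asum F x \<le> nrm x"
proof -
  obtain C where C: "0 \<le> C" "\<And>F. F \<in> \<F> \<Longrightarrow> asum F x \<le> C" using X_bounded assms(1) by blast
  then have "Phi \<F> x \<le> ennreal C" by (simp add: Phi_le_iff)
  then have "Phi \<F> x = ennreal (nrm x)"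
    unfolding X_norm_def by (metis ennreal_enn2real ennreal_less_top le_less_trans)
  then have "Phi \<F> x \<le> ennreal (nrm x)" by simp
  moreover have "0 \<le> nrm x" by (simp add: X_norm_def)
  ultimately show ?thesis using Phi_le_iff assms(2) by blast
qed

lemma norm_leI:
  assumes "\<And>F. F \<in> \<F> \<Longrightarrow> asum F x \<le> C" "0 \<le> C"
  shows "nrm x \<le> C"
proof -
  have "Phi \<F> x \<le> ennreal C" using assms by (simp add: Phi_le_iff)
  then show ?thesis unfolding X_norm_def by (rule enn2real_leI[OF assms(2)])
qed

lemma norm_nonneg [simp]: "0 \<le> nrm x"
  by (simp add: X_norm_def)

lemma asum_subset_le_norm:
  assumes "x \<in> X" "F \<in> \<F>" "E \<subseteq> F"
  shows "asum E x \<le> nrm x"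
proof -
  have "asum E x \<le> asum F x" using assms finite_members by (intro sum_mono2) auto
  then show ?thesis using asum_le_norm[OF assms(1,2)] by linarith
qed

text \<open>Every coordinate lies in some member, since the family is a cover. This makes the
  coordinate functionals continuous and the norm definite.\<close>

lemma abs_le_norm:
  assumes "x \<in> X" shows "\<bar>x i\<bar> \<le> nrm x"
proof -
  have "i \<in> \<Union>\<F>" by (simp add: cover)
  then obtain F where "F \<in> \<F>" "i \<in> F" by (rule UnionE)
  then show ?thesis using asum_subset_le_norm[OF assms, of F "{i}"] by simp
qed

lemma X_mono:
  assumes "x \<in> X" "\<And>i. \<bar>y i\<bar> \<le> \<bar>x i\<bar>"
  shows "y \<in> X"
proof -
  have "asum E y \<le> asum E x" for E by (rule sum_mono) (rule assms)
  then show ?thesis using assms(1) unfolding X_iff by (meson order_trans)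
qed

lemma norm_mono:
  assumes "x \<in> X" "\<And>i. \<bar>y i\<bar> \<le> \<bar>x i\<bar>"
  shows "nrm y \<le> nrm x"
proof (rule norm_leI)
  fix F assume "F \<in> \<F>"
  have "asum F y \<le> asum F x" by (rule sum_mono) (rule assms)
  then show "asum F y \<le> nrm x" using asum_le_norm[OF assms(1) \<open>F \<in> \<F>\<close>] by linarith
qed simp

lemma X_finite_support:
  assumes "\<And>i. i \<ge> n \<Longrightarrow> x i = 0"
  shows "x \<in> X"
proof -
  have "asum (F - {..<n}) x = 0" for F by (intro sum.neutral) (auto intro: assms)
  then show ?thesis unfolding X_iff by (metis order_less_imp_le)
qed

lemma coord_proj_X: "coord_proj {..<n} x \<in> X"
  by (rule X_finite_support[of n]) simp

lemma unit_vec_X: "unit_vec n \<in> X"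
  by (rule X_finite_support[of "Suc n"]) (simp add: unit_vec_def)

lemma asum_add_le: "asum E (x + y) \<le> asum E x + asum E y"
  by (simp add: sum.distrib[symmetric] sum_mono abs_triangle_ineq)

text \<open>The distance is measured by \<open>asum\<close> over members and not by
  \<open>nrm (x - y)\<close>: before \<open>x\<close> is known to lie in the space,
  \<open>Phi\<close> may be infinite at \<open>x - y\<close>, and \<open>enn2real\<close> would turn
  that into 0.\<close>

lemma X_closed:
  assumes "\<And>\<epsilon>. \<epsilon> > 0 \<Longrightarrow> \<exists>y\<in>X. \<forall>F\<in>\<F>. asum F (x - y) \<le> \<epsilon>"
  shows "x \<in> X"
  unfolding X_iff
proof (intro allI impI)
  fix \<epsilon> :: real assume "\<epsilon> > 0"
  then obtain y where y: "y \<in> X" "\<forall>F\<in>\<F>. asum F (x - y) \<le> \<epsilon>/2" using assms[of "\<epsilon>/2"] by auto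
  obtain n where n: "\<forall>F\<in>\<F>. asum (F - {..<n}) y \<le> \<epsilon>/2"
    using y(1) \<open>\<epsilon> > 0\<close> unfolding X_iff by (meson half_gt_zero)
  have "asum (F - {..<n}) x \<le> \<epsilon>" if "F \<in> \<F>" for F
  proof -
    have "asum (F - {..<n}) x \<le> asum (F - {..<n}) (x - y) + asum (F - {..<n}) y"
      using asum_add_le[where x = "x - y" and y = y and E = "F - {..<n}"] by simp
    moreover have "asum (F - {..<n}) (x - y) \<le> asum F (x - y)"
      using finite_members[OF that] by (intro sum_mono2) auto
    ultimately show ?thesis using n y(2) that by fastforce
  qed
  then show "\<exists>n. \<forall>F\<in>\<F>. asum (F - {..<n}) x \<le> \<epsilon>" by blast
qed

lemma X_add:
  assumes "x \<in> X" "y \<in> X" shows "x + y \<in> X"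
  unfolding X_iff
proof (intro allI impI)
  fix \<epsilon> :: real assume "\<epsilon> > 0"
  obtain m where m: "\<forall>F\<in>\<F>. asum (F - {..<m}) x \<le> \<epsilon>/2"
    using assms(1) \<open>\<epsilon> > 0\<close> unfolding X_iff by (meson half_gt_zero)
  obtain n where n: "\<forall>F\<in>\<F>. asum (F - {..<n}) y \<le> \<epsilon>/2"
    using assms(2) \<open>\<epsilon> > 0\<close> unfolding X_iff by (meson half_gt_zero)
  have "asum (F - {..<max m n}) (x + y) \<le> \<epsilon>" if "F \<in> \<F>" for F
  proof -
    have "asum (F - {..<max m n}) x \<le> asum (F - {..<m}) x" "asum (F - {..<max m n}) y \<le> asum (F - {..<n}) y"
      using finite_members[OF that] by (auto intro!: sum_mono2)
    then show ?thesis
      using asum_add_le[of x y "F - {..<max m n}"] m n that by fastforce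
  qed
  then show "\<exists>n. \<forall>F\<in>\<F>. asum (F - {..<n}) (x + y) \<le> \<epsilon>" by blast
qed

lemma X_scale:
  assumes "x \<in> X" shows "c *\<^sub>R x \<in> X"
  unfolding X_iff
proof (intro allI impI)
  fix \<epsilon> :: real assume "\<epsilon> > 0"
  then have pos: "\<epsilon> / (\<bar>c\<bar> + 1) > 0" by simp
  obtain m where m: "\<forall>F\<in>\<F>. asum (F - {..<m}) x \<le> \<epsilon> / (\<bar>c\<bar> + 1)"
    using assms pos unfolding X_iff by meson
  have "asum (F - {..<m}) (c *\<^sub>R x) \<le> \<epsilon>" if "F \<in> \<F>" for F
  proof -
    have "asum (F - {..<m}) (c *\<^sub>R x) = \<bar>c\<bar> * asum (F - {..<m}) x"
      by (simp add: abs_mult sum_distrib_left)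
    also have "\<dots> \<le> (\<bar>c\<bar> + 1) * (\<epsilon> / (\<bar>c\<bar> + 1))"
      using m that pos by (intro mult_mono) (auto simp: sum_nonneg)
    also have "\<dots> = \<epsilon>"
      by (metis abs_ge_zero add.commute add_pos_nonneg less_numeral_extra(3) nonzero_eq_divide_eq
          times_divide_eq_right mult.commute zero_less_one)
    finally show ?thesis .
  qed
  then show "\<exists>n. \<forall>F\<in>\<F>. asum (F - {..<n}) (c *\<^sub>R x) \<le> \<epsilon>" by blast
qed

lemma zero_X: "0 \<in> X"
  by (rule X_finite_support[of 0]) simp

lemma subspace_X: "subspace X"
  by (intro subspaceI zero_X X_add X_scale)

lemmas X_diff = subspace_diff[OF subspace_X]
lemmas X_sum = subspace_sum[OF subspace_X]

lemma norm_zero [simp]: "nrm 0 = 0"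
  using norm_leI[of 0 0] norm_nonneg[of 0] by (simp add: antisym)

lemma norm_eq_0: "x \<in> X \<Longrightarrow> nrm x = 0 \<longleftrightarrow> x = 0"
  using abs_le_norm[of x] by (metis abs_le_zero_iff ext norm_zero zero_fun_apply)

lemma norm_triangle:
  assumes "x \<in> X" "y \<in> X" shows "nrm (x + y) \<le> nrm x + nrm y"
proof (rule norm_leI)
  fix F assume "F \<in> \<F>"
  then show "asum F (x + y) \<le> nrm x + nrm y"
    using asum_add_le[of x y F] asum_le_norm[OF assms(1), of F] asum_le_norm[OF assms(2), of F] by simp
qed simp

lemma norm_abs_eq: "(\<And>i. \<bar>y i\<bar> = \<bar>x i\<bar>) \<Longrightarrow> nrm y = nrm x"
  by (simp add: X_norm_def Phi_def)

lemma norm_minus_commute: "nrm (x - y) = nrm (y - x)"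
  by (rule norm_abs_eq) simp

lemma norm_uminus [simp]: "nrm (- x) = nrm x"
  by (rule norm_abs_eq) simp

lemma norm_scale_le:
  assumes "x \<in> X" shows "nrm (c *\<^sub>R x) \<le> \<bar>c\<bar> * nrm x"
proof (rule norm_leI)
  fix F assume "F \<in> \<F>"
  have "asum F (c *\<^sub>R x) = \<bar>c\<bar> * asum F x" by (simp add: abs_mult sum_distrib_left)
  then show "asum F (c *\<^sub>R x) \<le> \<bar>c\<bar> * nrm x"
    using asum_le_norm[OF assms \<open>F \<in> \<F>\<close>] by (simp add: mult_left_mono)
qed simp

lemma norm_scale:
  assumes "x \<in> X" shows "nrm (c *\<^sub>R x) = \<bar>c\<bar> * nrm x"
proof (cases "c = 0")
  case False
  have "nrm x = nrm ((1/c) *\<^sub>R (c *\<^sub>R x))" using False by simp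
  also have "\<dots> \<le> \<bar>1/c\<bar> * nrm (c *\<^sub>R x)" by (rule norm_scale_le[OF X_scale[OF assms]])
  finally have "\<bar>c\<bar> * nrm x \<le> nrm (c *\<^sub>R x)" using False by (simp add: field_simps)
  then show ?thesis using norm_scale_le[OF assms, of c] by simp
qed simp

lemma norm_sum_le:
  assumes "\<And>k. k \<in> A \<Longrightarrow> x k \<in> X"
  shows "nrm (\<Sum>k\<in>A. x k) \<le> (\<Sum>k\<in>A. nrm (x k))"
  using assms
proof (induction A rule: infinite_finite_induct)
  case (insert k A)
  then have "nrm (x k + (\<Sum>k\<in>A. x k)) \<le> nrm (x k) + nrm (\<Sum>k\<in>A. x k)"
    by (intro norm_triangle X_sum) auto
  moreover have "nrm (\<Sum>k\<in>A. x k) \<le> (\<Sum>k\<in>A. nrm (x k))" using insert by blast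
  ultimately show ?case by (simp only: sum.insert[OF insert.hyps])
qed simp_all

lemma norm_diff_triangle:
  assumes "x \<in> X" "y \<in> X" shows "nrm x \<le> nrm y + nrm (x - y)"
  using norm_triangle[OF assms(2) X_diff[OF assms]] by simp

lemma tail_norm:
  assumes "x \<in> X" "\<epsilon> > 0"
  obtains n where "\<And>m. m \<ge> n \<Longrightarrow> nrm (x - coord_proj {..<m} x) \<le> \<epsilon>"
proof -
  obtain n where n: "\<forall>F\<in>\<F>. asum (F - {..<n}) x \<le> \<epsilon>"
    using assms unfolding X_iff by meson
  have "nrm (x - coord_proj {..<m} x) \<le> \<epsilon>" if "m \<ge> n" for m
  proof (rule norm_leI)
    fix F assume F: "F \<in> \<F>"
    have "asum F (x - coord_proj {..<m} x) = (\<Sum>i\<in>F. if i \<in> F - {..<m} then \<bar>x i\<bar> else 0)"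
      by (rule sum.cong) auto
    also have "\<dots> = asum (F - {..<m}) x"
      using finite_members[OF F] by (subst sum.inter_restrict[symmetric]) (auto intro: sum.cong)
    also have "\<dots> \<le> asum (F - {..<n}) x"
      using finite_members[OF F] \<open>m \<ge> n\<close> by (intro sum_mono2) auto
    finally show "asum F (x - coord_proj {..<m} x) \<le> \<epsilon>" using n F by fastforce
  qed (use assms in simp)
  then show thesis by (rule that)
qed

section \<open>Metric structure and the unit vector basis\<close>

lemma Metric_space_X: "Metric_space X (\<lambda>x y. nrm (x - y))"
proof
  fix x y z assume *: "x \<in> X" "y \<in> X" "z \<in> X"
  have "x - z = (x - y) + (y - z)" by simp
  then show "nrm (x - z) \<le> nrm (x - y) + nrm (y - z)"
    using norm_triangle[OF X_diff X_diff] * by metis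
qed (auto simp: norm_minus_commute norm_eq_0 X_diff)

lemma closedin_iff:
  "closedin (norm_topology X nrm) Y \<longleftrightarrow>
    Y \<subseteq> X \<and> (\<forall>x\<in>X. (\<forall>\<epsilon>>0. \<exists>y\<in>Y. nrm (x - y) < \<epsilon>) \<longrightarrow> x \<in> Y)"
proof -
  interpret M: Metric_space X "\<lambda>x y. nrm (x - y)" by (rule Metric_space_X)
  show ?thesis
    unfolding norm_topology_def M.closedin_metric disjnt_def by (fastforce simp: M.mball_def)
qed

lemma closure_ofD:
  assumes "x \<in> norm_topology X nrm closure_of S" "S \<subseteq> T" "closedin (norm_topology X nrm) T"
  shows "x \<in> T"
  using assms closure_of_minimal by blast

lemma schauder_basis_unit_vec: "schauder_basis X nrm unit_vec"
  unfolding schauder_basis_def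
proof (intro conjI ballI)
  show "range unit_vec \<subseteq> X" using unit_vec_X by blast
  fix x assume x: "x \<in> X"
  show "\<exists>!a. (\<lambda>n. nrm (x - (\<Sum>k<n. a k *\<^sub>R unit_vec k))) \<longlonglongrightarrow> 0"
    unfolding sum_unit_vec
  proof (rule ex1I[of _ x])
    show "(\<lambda>n. nrm (x - coord_proj {..<n} x)) \<longlonglongrightarrow> 0"
    proof (rule LIMSEQ_I)
      fix r :: real assume "r > 0"
      then obtain n where "\<And>m. m \<ge> n \<Longrightarrow> nrm (x - coord_proj {..<m} x) \<le> r/2"
        using tail_norm[OF x, of "r/2"] by auto
      with \<open>r > 0\<close> show "\<exists>no. \<forall>n\<ge>no. norm (nrm (x - coord_proj {..<n} x) - 0) < r"
        by (intro exI[of _ n]) fastforce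
    qed
    fix a assume a: "(\<lambda>n. nrm (x - coord_proj {..<n} a)) \<longlonglongrightarrow> 0"
    show "a = x"
    proof
      fix i
      have "\<bar>x i - a i\<bar> \<le> nrm (x - coord_proj {..<n} a)" if "n \<ge> Suc i" for n
        using abs_le_norm[OF X_diff[OF x coord_proj_X[of n a]], of i] that by auto
      then have "\<bar>x i - a i\<bar> \<le> 0"
        by (intro tendsto_lowerbound[OF a]) (auto simp: eventually_sequentially)
      then show "a i = x i" by simp
    qed
  qed
qed

end

section \<open>Compactness and the greedy construction\<close>

text \<open>A basic open set of the product restricts only finitely many coordinates, and
  \<open>n\<close> is taken above all of them.\<close>

lemma closed_chi_separation:
  assumes "closed C" "chi A \<notin> C"
  obtains n where "\<forall>B. B \<inter> {..<n} = A \<inter> {..<n} \<longrightarrow> chi B \<notin> C"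
proof -
  have "openin (product_topology (\<lambda>_::nat. euclidean :: bool topology) UNIV) (- C)"
    using assms(1) by (simp add: euclidean_product_topology open_Compl)
  then obtain U :: "nat \<Rightarrow> bool set" where U: "chi A \<in> PiE UNIV U"
      "finite {i. U i \<noteq> topspace euclidean}" "PiE UNIV U \<subseteq> - C"
    using product_topology_open_contains_basis[of "\<lambda>_. euclidean" UNIV "- C" "chi A"] assms(2)
    by auto
  obtain n where n: "\<forall>i\<in>{i. U i \<noteq> topspace euclidean}. i < n"
    using U(2) finite_nat_set_iff_bounded by blast
  have "chi B \<notin> C" if B: "B \<inter> {..<n} = A \<inter> {..<n}" for B
  proof -
    have "chi B i \<in> U i" for i
    proof (cases "i < n")
      case True
      then have "chi B i = chi A i" using B unfolding chi_def by (metis IntD1 IntI lessThan_iff)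
      then show ?thesis using U(1) by (simp add: PiE_iff)
    next
      case False
      then have "U i = UNIV" using n by auto
      then show ?thesis by simp
    qed
    then have "chi B \<in> PiE UNIV U" by (simp add: PiE_iff)
    then show ?thesis using U(3) by blast
  qed
  then show thesis by (intro that) blast
qed

lemma open_cylinder: "open {f :: nat \<Rightarrow> bool. \<forall>i<n. f i = g i}"
proof -
  have "{f :: nat \<Rightarrow> bool. \<forall>i<n. f i = g i} = (\<Inter>i\<in>{..<n}. (\<lambda>f. f i) -` {g i})" by auto
  moreover have "open ((\<lambda>f :: nat \<Rightarrow> bool. f i) -` {g i})" for i
    by (rule open_vimage[OF open_discrete]) simp
  ultimately show ?thesis by (simp add: open_INT)
qed

lemma chi_in_closure_iff:
  "chi A \<in> closure (chi ` \<F>) \<longleftrightarrow> (\<forall>n. \<exists>F\<in>\<F>. F \<inter> {..<n} = A \<inter> {..<n})"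
proof
  assume A: "chi A \<in> closure (chi ` \<F>)"
  show "\<forall>n. \<exists>F\<in>\<F>. F \<inter> {..<n} = A \<inter> {..<n}"
  proof
    fix n
    let ?U = "{f. \<forall>i<n. f i = chi A i}"
    have "chi A \<in> ?U \<inter> closure (chi ` \<F>)" using A by simp
    then have "?U \<inter> closure (chi ` \<F>) \<noteq> {}" by (rule ex_in_conv[THEN iffD1, OF exI])
    then have "?U \<inter> chi ` \<F> \<noteq> {}"
      by (simp only: open_Int_closure_eq_empty[OF open_cylinder] not_False_eq_True)
    then obtain f where "f \<in> ?U \<inter> chi ` \<F>" by (rule ex_in_conv[THEN iffD2, THEN exE])
    then have f: "f \<in> ?U" "f \<in> chi ` \<F>" by (rule IntD1, rule IntD2)
    from f(2) obtain F where F: "f = chi F" "F \<in> \<F>" by (rule imageE)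
    have "i \<in> F \<longleftrightarrow> i \<in> A" if "i < n" for i using f(1) that by (simp add: F(1) chi_def)
    then have "F \<inter> {..<n} = A \<inter> {..<n}" by (intro set_eqI) (metis IntD1 IntD2 IntI lessThan_iff)
    with F(2) show "\<exists>F\<in>\<F>. F \<inter> {..<n} = A \<inter> {..<n}" by (rule rev_bexI)
  qed
next
  assume *: "\<forall>n. \<exists>F\<in>\<F>. F \<inter> {..<n} = A \<inter> {..<n}"
  show "chi A \<in> closure (chi ` \<F>)"
  proof (rule ccontr)
    assume "chi A \<notin> closure (chi ` \<F>)"
    then obtain n where n: "\<forall>B. B \<inter> {..<n} = A \<inter> {..<n} \<longrightarrow> chi B \<notin> closure (chi ` \<F>)"
      by (rule closed_chi_separation[OF closed_closure])
    from * have "\<exists>F\<in>\<F>. F \<inter> {..<n} = A \<inter> {..<n}" by (rule spec)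
    then obtain F where F: "F \<in> \<F>" "F \<inter> {..<n} = A \<inter> {..<n}" by (rule bexE)
    have "chi F \<in> closure (chi ` \<F>)" by (rule subsetD[OF closure_subset imageI[OF F(1)]])
    then show False using n F(2) by simp
  qed
qed

lemma precompact_iff:
  "precompact_family \<F> \<longleftrightarrow> (\<forall>A. (\<forall>n. \<exists>F\<in>\<F>. F \<inter> {..<n} = A \<inter> {..<n}) \<longrightarrow> finite A)"
  unfolding precompact_family_def chi_in_closure_iff ..

text \<open>Compactness of the Cantor space by Koenig's argument: a pattern below \<open>m\<close>
  shared by infinitely many \<open>G n\<close> has two extensions below \<open>Suc m\<close>, and
  one of them is again shared infinitely often. The union of a coherent chain of such patterns is
  the cluster point.\<close>

lemma cluster_set:
  fixes G :: "nat \<Rightarrow> nat set"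
  obtains A where "\<And>m. infinite {n. G n \<inter> {..<m} = A \<inter> {..<m}}"
proof -
  let ?P = "\<lambda>m D. D \<subseteq> {..<m} \<and> infinite {n. G n \<inter> {..<m} = D}"
  have "\<exists>D. \<forall>m. ?P m (D m) \<and> D m = D (Suc m) \<inter> {..<m}"
  proof (rule dependent_nat_choice)
    show "\<exists>D. ?P 0 D" by auto
    fix D m assume P: "?P m D"
    have "{n. G n \<inter> {..<m} = D} \<subseteq>
        {n. G n \<inter> {..<Suc m} = D} \<union> {n. G n \<inter> {..<Suc m} = insert m D}"
      using P by (auto simp: lessThan_Suc)
    then have "infinite {n. G n \<inter> {..<Suc m} = D} \<or> infinite {n. G n \<inter> {..<Suc m} = insert m D}"
      using P by (meson finite_Un finite_subset)
    then show "\<exists>D'. ?P (Suc m) D' \<and> D = D' \<inter> {..<m}"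
    proof
      assume "infinite {n. G n \<inter> {..<Suc m} = D}"
      then show ?thesis using P by (intro exI[of _ D]) auto
    next
      assume "infinite {n. G n \<inter> {..<Suc m} = insert m D}"
      then show ?thesis using P by (intro exI[of _ "insert m D"]) auto
    qed
  qed
  then obtain D where D: "\<And>m. ?P m (D m)" "\<And>m. D m = D (Suc m) \<inter> {..<m}" by blast
  have mono: "D m = D (m + k) \<inter> {..<m}" for m k
  proof (induction k)
    case 0 then show ?case using D(1)[of m] by auto
  next
    case (Suc k)
    have "D (m + k) \<inter> {..<m} = D (Suc (m + k)) \<inter> {..<m}" by (subst D(2)) auto
    then show ?case using Suc by simp
  qed
  have "(\<Union>k. D k) \<inter> {..<m} = D m" for m
  proof
    show "(\<Union>k. D k) \<inter> {..<m} \<subseteq> D m"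
    proof
      fix i assume "i \<in> (\<Union>k. D k) \<inter> {..<m}"
      then obtain k where "i \<in> D k" "i < m" by auto
      show "i \<in> D m"
      proof (cases "k \<le> m")
        case True
        then have "D k = D m \<inter> {..<k}" using mono[of k "m - k"] by simp
        with \<open>i \<in> D k\<close> show ?thesis by blast
      next
        case False
        then have "D m = D k \<inter> {..<m}" using mono[of m "k - m"] by simp
        with \<open>i \<in> D k\<close> \<open>i < m\<close> show ?thesis by simp
      qed
    qed
    show "D m \<subseteq> (\<Union>k. D k) \<inter> {..<m}" using D(1)[of m] by auto
  qed
  then have "infinite {n. G n \<inter> {..<m} = (\<Union>k. D k) \<inter> {..<m}}" for m
    using D(1)[of m] by simp
  then show thesis by (rule that)
qed

text \<open>\<open>set_encode\<close> numbers the finite sets, so the bounds tend to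
  \<open>r\<close> along that enumeration. Infinite sets all get code 0, which is why the last
  clause speaks of finite sets only.\<close>

lemma increasing_weights:
  assumes "r > 0"
  obtains c :: "nat set \<Rightarrow> real" where "\<forall>E. 0 \<le> c E" "\<forall>E. c E < r"
    "\<forall>\<eta>>0. finite {E. finite E \<and> c E < r - \<eta>}"
proof -
  define c where "c E = r - r / (real (set_encode E) + 1)" for E
  show thesis
  proof (rule that)
    show "\<forall>E. 0 \<le> c E" "\<forall>E. c E < r"
      using assms by (simp_all add: c_def field_simps)
    show "\<forall>\<eta>>0. finite {E. finite E \<and> c E < r - \<eta>}"
    proof (intro allI impI)
      fix \<eta> :: real assume "\<eta> > 0"
      obtain k where k: "r / \<eta> < real k" using reals_Archimedean2 by blast
      have "set_encode E < k" if "c E < r - \<eta>" for E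
      proof -
        have "\<eta> < r / (real (set_encode E) + 1)" using that by (simp add: c_def)
        then have "real (set_encode E) + 1 < r / \<eta>" using \<open>\<eta> > 0\<close> by (simp add: field_simps)
        then show ?thesis using k by linarith
      qed
      then have "set_encode ` {E. finite E \<and> c E < r - \<eta>} \<subseteq> {..<k}" by auto
      then have "finite (set_encode ` {E. finite E \<and> c E < r - \<eta>})" by (rule finite_subset) simp
      then show "finite {E. finite E \<and> c E < r - \<eta>}"
        by (rule finite_imageD) (rule inj_on_subset[OF inj_on_set_encode], auto)
    qed
  qed
qed

lemma greedy_maximal:
  fixes Q :: "(nat \<Rightarrow> real) \<Rightarrow> bool" and D :: "real set"
  assumes D: "closed D" "0 \<in> D" "D \<subseteq> {0..}"
    and zero: "Q (\<lambda>_. 0)"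
    and mono: "\<And>a b. Q b \<Longrightarrow> (\<And>n. 0 \<le> a n \<and> a n \<le> b n) \<Longrightarrow> Q a"
    and bounded: "\<And>n. \<exists>B. \<forall>a. Q a \<longrightarrow> a n \<le> B"
    and sup: "\<And>a n s. s > 0 \<Longrightarrow> (\<And>t. 0 \<le> t \<Longrightarrow> t < s \<Longrightarrow> Q (a(n := t))) \<Longrightarrow> Q (a(n := s))"
    and local: "\<And>a. (\<And>n. Q (\<lambda>k. if k < n then a k else 0)) \<Longrightarrow> Q a"
  obtains a where "\<forall>n. a n \<in> D" "Q a" "\<forall>n. \<forall>d\<in>D. d > a n \<longrightarrow> \<not> Q (a(n := d))"
proof -
  let ?P = "\<lambda>n p. Q p \<and> (\<forall>k. p k \<in> D) \<and> (\<forall>k\<ge>n. p k = 0)"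
  let ?R = "\<lambda>n p q. (\<exists>s. q = p(n := s)) \<and> (\<forall>d\<in>D. d > q n \<longrightarrow> \<not> Q (p(n := d)))"
  have "\<exists>p. \<forall>n. ?P n (p n) \<and> ?R n (p n) (p (Suc n))"
  proof (rule dependent_nat_choice)
    show "\<exists>p. ?P 0 p" using zero D(2) by (intro exI[of _ "\<lambda>_. 0"]) auto
    fix p n assume P: "?P n p"
    let ?S = "{t \<in> D. Q (p(n := t))}"
    obtain B where B: "\<And>a. Q a \<Longrightarrow> a n \<le> B" using bounded by blast
    have bdd: "bdd_above ?S"
    proof (rule bdd_aboveI)
      fix t assume "t \<in> ?S" then show "t \<le> B" using B[of "p(n := t)"] by simp
    qed
    have "p(n := 0) = p" using P by auto
    then have 0: "0 \<in> ?S" using P D(2) by simp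
    define s where "s = Sup ?S"
    have "s \<in> D" unfolding s_def
      by (rule closed_subset_contains_Sup[OF D(1) _ _ bdd]) (use 0 in auto)
    have "Q (p(n := s))"
    proof (cases "s > 0")
      case True
      show ?thesis
      proof (rule sup[OF True])
        fix t assume t: "0 \<le> t" "t < s"
        \<comment> \<open>\<open>D\<close> may have gaps, so \<open>t\<close> itself need not belong
          to \<open>?S\<close>; a larger element of \<open>?S\<close> exists and \<open>mono\<close>
          passes down from it.\<close>
        then obtain t' where t': "t' \<in> ?S" "t < t'"
          unfolding s_def using less_cSup_iff[OF _ bdd] 0 by blast
        show "Q (p(n := t))"
        proof (rule mono)
          show "Q (p(n := t'))" using t' by simp
          fix k show "0 \<le> (p(n := t)) k \<and> (p(n := t)) k \<le> (p(n := t')) k"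
            using t t' P D(3) by auto
        qed
      qed
    next
      case False
      then have "s = 0" using \<open>s \<in> D\<close> D(3) by fastforce
      then show ?thesis using 0 by simp
    qed
    moreover have "\<not> Q (p(n := d))" if "d \<in> D" "d > s" for d
      using cSup_upper[OF _ bdd, of d] that unfolding s_def by fastforce
    ultimately show "\<exists>q. ?P (Suc n) q \<and> ?R n p q"
      using P \<open>s \<in> D\<close> by (intro exI[of _ "p(n := s)"]) auto
  qed
  then obtain p where P: "\<And>n. ?P n (p n)" and R: "\<And>n. ?R n (p n) (p (Suc n))" by blast
  define a where "a n = p (Suc n) n" for n
  have p: "p n = (\<lambda>k. if k < n then a k else 0)" for n
  proof (induction n)
    case 0 then show ?case using P[of 0] by auto
  next
    case (Suc n)
    obtain s where s: "p (Suc n) = (p n)(n := s)" using R by blast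
    show ?case
    proof
      fix k show "p (Suc n) k = (if k < Suc n then a k else 0)"
        using Suc s by (auto simp: a_def less_Suc_eq)
    qed
  qed
  show thesis
  proof (rule that)
    show aD: "\<forall>n. a n \<in> D" using P by (simp add: a_def)
    show "Q a" by (rule local) (use P p in metis)
    show "\<forall>n. \<forall>d\<in>D. d > a n \<longrightarrow> \<not> Q (a(n := d))"
    proof (intro allI ballI impI notI)
      fix n d assume d: "d \<in> D" "d > a n"
      assume "Q (a(n := d))"
      then have "Q ((p n)(n := d))"
        by (rule mono) (use aD D(3) d(1) in \<open>auto simp: p\<close>)
      then show False using R[of n] d by (auto simp: a_def)
    qed
  qed
qed

section \<open>Maximal sequences under the strict constraints\<close>

context cover_family
begin

text \<open>The weights \<open>c\<close> make room: since they tend to their strict upper bound \<open>r\<close>, and since by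
  compactness the norm of \<open>s\<close> is attained, hence less than \<open>r\<close>, only finitely many constraints are
  tight, and these do not see vectors supported far out.\<close>

lemma slack:
  assumes precompact: "precompact_family \<F>"
    and c: "\<forall>E. c E < r" "\<forall>\<eta>>0. finite {E. finite E \<and> c E < r - \<eta>}"
    and s: "s \<in> X" "\<forall>F\<in>\<F>. \<forall>E\<subseteq>F. asum E s \<le> c E"
  obtains \<eta> K where "\<eta> > 0"
    "\<forall>z. (\<forall>i<K. z i = 0) \<longrightarrow> (\<forall>F\<in>\<F>. asum F z \<le> \<eta>) \<longrightarrow>
        (\<forall>F\<in>\<F>. \<forall>E\<subseteq>F. asum E s + asum E z \<le> c E)"
proof -
  have "\<exists>\<eta>>0. \<forall>F\<in>\<F>. asum F s \<le> r - \<eta>"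
  proof (rule ccontr)
    assume "\<not> (\<exists>\<eta>>0. \<forall>F\<in>\<F>. asum F s \<le> r - \<eta>)"
    then have "\<forall>n. \<exists>F\<in>\<F>. asum F s > r - 1 / real (Suc n)"
      by (meson not_le zero_less_divide_1_iff of_nat_0_less_iff zero_less_Suc)
    then obtain G where G: "\<And>n. G n \<in> \<F>" "\<And>n. asum (G n) s > r - 1 / real (Suc n)" by metis
    obtain A where A: "\<And>m. infinite {n. G n \<inter> {..<m} = A \<inter> {..<m}}" using cluster_set by blast
    have agree: "\<exists>n\<ge>k. G n \<inter> {..<m} = A \<inter> {..<m}" for m k
      using A[of m] unfolding infinite_nat_iff_unbounded_le by auto
    have "\<exists>F\<in>\<F>. F \<inter> {..<m} = A \<inter> {..<m}" for m using G(1) agree[of 0 m] by metis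
    then have "finite A" using precompact by (simp add: precompact_iff)
    then obtain N where N: "A \<subseteq> {..<N}" using finite_nat_iff_bounded by blast
    obtain n where "G n \<inter> {..<N} = A \<inter> {..<N}" using agree[of 0] by blast
    \<comment> \<open>\<open>A\<close> is a limit of members and perhaps not a member, but beyond
      \<open>N\<close> nothing of it is left, so it is a subset of \<open>G n\<close>; the
      constraint on subsets applies to it.\<close>
    then have "asum A s \<le> c A" using s(2) G(1)[of n] N by (metis Int_absorb2 inf.cobounded1)
    \<comment> \<open>Half of the gap at \<open>A\<close>. A late \<open>G n\<close> consists of
      \<open>A\<close> and a tail of weight at most \<open>\<epsilon>\<close>, so its sum stays
      below \<open>r\<close> by at least \<open>\<epsilon>\<close>, although it was chosen to come
      within \<open>1 / real (Suc n)\<close> of \<open>r\<close>.\<close>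
    define \<epsilon> where "\<epsilon> = (r - c A) / 2"
    have "\<epsilon> > 0" using c(1) by (simp add: \<epsilon>_def)
    obtain M where M: "\<forall>F\<in>\<F>. asum (F - {..<M}) s \<le> \<epsilon>"
      using s(1) \<open>\<epsilon> > 0\<close> unfolding X_iff by meson
    obtain k where k: "1 / real (Suc k) < \<epsilon>" using nat_approx_posE[OF \<open>\<epsilon> > 0\<close>] by metis
    obtain n where n: "n \<ge> k" "G n \<inter> {..<max M N} = A \<inter> {..<max M N}" using agree by blast
    have "asum (G n) s = asum (G n \<inter> {..<max M N}) s + asum (G n - {..<max M N}) s"
      using finite_members[OF G(1)] by (simp add: sum.Int_Diff)
    also have "G n \<inter> {..<max M N} = A" using n N by auto
    also have "asum (G n - {..<max M N}) s \<le> asum (G n - {..<M}) s"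
      using finite_members[OF G(1)] by (intro sum_mono2) auto
    also have "\<dots> \<le> \<epsilon>" using M G(1) by blast
    finally have "asum (G n) s \<le> c A + \<epsilon>" using \<open>asum A s \<le> c A\<close> by linarith
    moreover have "1 / real (Suc n) \<le> 1 / real (Suc k)" using n(1) by (simp add: frac_le)
    moreover have "r = c A + 2 * \<epsilon>" by (simp add: \<epsilon>_def field_simps)
    ultimately show False using G(2)[of n] k by linarith
  qed
  then obtain \<eta> where \<eta>: "\<eta> > 0" "\<And>F. F \<in> \<F> \<Longrightarrow> asum F s \<le> r - \<eta>" by blast
  \<comment> \<open>Half of \<open>\<eta>\<close> is kept for \<open>z\<close>. If the bound of
    \<open>E\<close> is at least \<open>r - \<eta>/2\<close>, then \<open>r - \<eta>\<close> from
    \<open>s\<close> and \<open>\<eta>/2\<close> from \<open>z\<close> fit under it. The other sets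
    are finitely many, and \<open>K\<close> lies above all their elements.\<close>
  have "finite (\<Union>{E. finite E \<and> c E < r - \<eta>/2})" using c(2) \<eta>(1) by auto
  then obtain K where K: "\<Union>{E. finite E \<and> c E < r - \<eta>/2} \<subseteq> {..<K}"
    using finite_nat_iff_bounded by blast
  show thesis
  proof (rule that[of "\<eta>/2" K])
    show "\<eta>/2 > 0" using \<eta>(1) by simp
    show "\<forall>z. (\<forall>i<K. z i = 0) \<longrightarrow> (\<forall>F\<in>\<F>. asum F z \<le> \<eta>/2) \<longrightarrow>
        (\<forall>F\<in>\<F>. \<forall>E\<subseteq>F. asum E s + asum E z \<le> c E)"
    proof (intro allI impI ballI)
      fix z F E assume z: "\<forall>i<K. z i = 0" "\<forall>F\<in>\<F>. asum F z \<le> \<eta>/2"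
        and FE: "F \<in> \<F>" "E \<subseteq> F"
      have "finite E" using FE finite_members finite_subset by blast
      show "asum E s + asum E z \<le> c E"
      proof (cases "c E < r - \<eta>/2")
        case True
        then have "E \<subseteq> {..<K}" using \<open>finite E\<close> K by blast
        then have "asum E z = 0" using z(1) by (intro sum.neutral) auto
        then show ?thesis using s(2) FE by simp
      next
        case False
        have "asum E s \<le> asum F s" "asum E z \<le> asum F z"
          using FE finite_members by (auto intro!: sum_mono2)
        then show ?thesis using False \<eta>(2)[OF FE(1)] bspec[OF z(2) FE(1)] by linarith
      qed
    qed
  qed
qed

text \<open>\<open>idx\<close> sends a coordinate to its block and \<open>\<beta>\<close> lists all
  block vectors in one sequence, so that \<open>a n\<close> multiplies block \<open>n\<close>. If
  the maximal sequence lies in the space, there is room far out for any vector of small norm; by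
  maximality every admissible increase on a late block must therefore have norm above a fixed
  \<open>\<eta>\<close>.\<close>

lemma maximal_multiplier:
  fixes idx :: "nat \<Rightarrow> nat" and \<beta> :: "nat \<Rightarrow> real"
  assumes precompact: "precompact_family \<F>"
    and D: "closed D" "0 \<in> D" "D \<subseteq> {0..}"
    and "r > 0" and \<beta>: "\<And>n. \<exists>i. idx i = n \<and> \<beta> i \<noteq> 0"
  obtains a where "\<forall>n. a n \<in> D" "\<forall>F\<in>\<F>. asum F (\<lambda>i. a (idx i) * \<beta> i) \<le> r"
    "(\<lambda>i. a (idx i) * \<beta> i) \<in> X \<longrightarrow> (\<exists>\<eta>>0. \<exists>K. \<forall>n\<ge>K. \<forall>d\<in>D. d > a n \<longrightarrow>
      (\<exists>F\<in>\<F>. asum F (\<lambda>i. if idx i = n then (d - a n) * \<beta> i else 0) > \<eta>))"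
proof -
  obtain c :: "nat set \<Rightarrow> real" where c: "\<forall>E. 0 \<le> c E" "\<forall>E. c E < r"
    "\<forall>\<eta>>0. finite {E. finite E \<and> c E < r - \<eta>}"
    by (rule increasing_weights[OF \<open>r > 0\<close>])
  define Q where "Q a \<longleftrightarrow> (\<forall>F\<in>\<F>. \<forall>E\<subseteq>F. asum E (\<lambda>i. a (idx i) * \<beta> i) \<le> c E)" for a
  obtain a where a: "\<forall>n. a n \<in> D" "Q a" "\<forall>n. \<forall>d\<in>D. d > a n \<longrightarrow> \<not> Q (a(n := d))"
  proof (rule greedy_maximal[OF D, of Q])
    show "Q (\<lambda>_. 0)" using c(1) by (simp add: Q_def)
  next
    fix a b :: "nat \<Rightarrow> real" assume *: "Q b" "\<And>n. 0 \<le> a n \<and> a n \<le> b n"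
    have "\<bar>a n\<bar> \<le> \<bar>b n\<bar>" for n using *(2)[of n] by linarith
    then have "asum E (\<lambda>i. a (idx i) * \<beta> i) \<le> asum E (\<lambda>i. b (idx i) * \<beta> i)" for E
      by (intro sum_mono) (simp add: abs_mult mult_right_mono)
    then show "Q a" using *(1) unfolding Q_def by (meson order_trans)
  next
    fix n
    obtain i where i: "idx i = n" "\<beta> i \<noteq> 0" using \<beta> by blast
    have "i \<in> \<Union>\<F>" by (simp add: cover)
    then obtain F where F: "F \<in> \<F>" "i \<in> F" by (rule UnionE)
    have "a n \<le> r / \<bar>\<beta> i\<bar>" if "Q a" for a
    proof -
      have "\<bar>a n * \<beta> i\<bar> \<le> c {i}" using that F i(1) unfolding Q_def by force
      then have "\<bar>a n\<bar> * \<bar>\<beta> i\<bar> \<le> r" using spec[OF c(2), of "{i}"] by (simp add: abs_mult)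
      then have "\<bar>a n\<bar> \<le> r / \<bar>\<beta> i\<bar>" using i(2) by (simp add: pos_le_divide_eq)
      then show ?thesis by linarith
    qed
    then show "\<exists>B. \<forall>a. Q a \<longrightarrow> a n \<le> B" by blast
  next
    fix a n and s :: real
    assume s: "s > 0" "\<And>t. 0 \<le> t \<Longrightarrow> t < s \<Longrightarrow> Q (a(n := t))"
    show "Q (a(n := s))"
      unfolding Q_def
    proof (intro ballI allI impI)
      fix F E assume FE: "F \<in> \<F>" "E \<subseteq> F"
      have "((\<lambda>t. (a(n := t)) (idx i)) \<longlongrightarrow> (a(n := s)) (idx i)) (at_left s)" for i
        by (cases "idx i = n") (auto intro: tendsto_eq_intros)
      then have "((\<lambda>t. asum E (\<lambda>i. (a(n := t)) (idx i) * \<beta> i)) \<longlongrightarrow>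
          asum E (\<lambda>i. (a(n := s)) (idx i) * \<beta> i)) (at_left s)"
        by (intro tendsto_sum tendsto_rabs tendsto_mult tendsto_const)
      then show "asum E (\<lambda>i. (a(n := s)) (idx i) * \<beta> i) \<le> c E"
      proof (rule tendsto_upperbound)
        show "\<forall>\<^sub>F t in at_left s. asum E (\<lambda>i. (a(n := t)) (idx i) * \<beta> i) \<le> c E"
          using eventually_at_left_real[OF s(1)]
        proof (rule eventually_mono)
          fix t assume "t \<in> {0<..<s}"
          then have "Q (a(n := t))" using s(2) by simp
          then show "asum E (\<lambda>i. (a(n := t)) (idx i) * \<beta> i) \<le> c E"
            using FE unfolding Q_def by blast
        qed
      qed simp
    qed
  next
    fix a assume *: "\<And>n. Q (\<lambda>k. if k < n then a k else 0)"
    show "Q a"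
      unfolding Q_def
    proof (intro ballI allI impI)
      fix F E assume FE: "F \<in> \<F>" "E \<subseteq> F"
      then have "finite (idx ` E)" using finite_members finite_subset by blast
      then obtain n where n: "idx ` E \<subseteq> {..<n}" using finite_nat_iff_bounded by blast
      have "asum E (\<lambda>i. a (idx i) * \<beta> i) =
          asum E (\<lambda>i. (if idx i < n then a (idx i) else 0) * \<beta> i)"
        using n by (intro sum.cong) auto
      then show "asum E (\<lambda>i. a (idx i) * \<beta> i) \<le> c E"
        using *[of n] FE unfolding Q_def by simp
    qed
  qed
  let ?s = "\<lambda>i. a (idx i) * \<beta> i"
  show thesis
  proof (rule that)
    show "\<forall>n. a n \<in> D" by (rule a(1))
    have sE: "\<forall>F\<in>\<F>. \<forall>E\<subseteq>F. asum E ?s \<le> c E" using a(2) unfolding Q_def .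
    show "\<forall>F\<in>\<F>. asum F ?s \<le> r"
    proof
      fix F assume "F \<in> \<F>"
      then have "asum F ?s \<le> c F" using sE by blast
      then show "asum F ?s \<le> r" using spec[OF c(2), of F] by linarith
    qed
    show "?s \<in> X \<longrightarrow> (\<exists>\<eta>>0. \<exists>K. \<forall>n\<ge>K. \<forall>d\<in>D. d > a n \<longrightarrow>
      (\<exists>F\<in>\<F>. asum F (\<lambda>i. if idx i = n then (d - a n) * \<beta> i else 0) > \<eta>))"
    proof
      assume sX: "?s \<in> X"
      obtain \<eta> K where \<eta>: "\<eta> > 0" and K:
        "\<forall>z. (\<forall>i<K. z i = 0) \<longrightarrow> (\<forall>F\<in>\<F>. asum F z \<le> \<eta>) \<longrightarrow>
          (\<forall>F\<in>\<F>. \<forall>E\<subseteq>F. asum E ?s + asum E z \<le> c E)"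
        by (rule slack[OF precompact c(2,3) sX sE])
      \<comment> \<open>The room is given in terms of coordinates. Only finitely many blocks meet
        the first \<open>K\<close> coordinates, so a block numbered \<open>K'\<close> or later
        vanishes on them.\<close>
      obtain K' where K': "idx ` {..<K} \<subseteq> {..<K'}" using finite_nat_iff_bounded by blast
      have "\<exists>F\<in>\<F>. asum F (\<lambda>i. if idx i = n then (d - a n) * \<beta> i else 0) > \<eta>"
        if n: "n \<ge> K'" and d: "d \<in> D" "d > a n" for n d
      proof (rule ccontr)
        let ?z = "\<lambda>i. if idx i = n then (d - a n) * \<beta> i else 0"
        assume "\<not> (\<exists>F\<in>\<F>. asum F ?z > \<eta>)"
        then have z: "\<forall>F\<in>\<F>. asum F ?z \<le> \<eta>" by (meson not_le)
        have z0: "\<forall>i<K. ?z i = 0" using K' n by force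
        have "Q (a(n := d))"
          unfolding Q_def
        proof (intro ballI allI impI)
          fix F E assume FE: "F \<in> \<F>" "E \<subseteq> F"
          have "asum E (\<lambda>i. (a(n := d)) (idx i) * \<beta> i) \<le> (\<Sum>i\<in>E. \<bar>?s i\<bar> + \<bar>?z i\<bar>)"
          proof (rule sum_mono)
            fix i
            have "d * \<beta> i = a n * \<beta> i + (d - a n) * \<beta> i" by (simp add: algebra_simps)
            then show "\<bar>(a(n := d)) (idx i) * \<beta> i\<bar> \<le> \<bar>?s i\<bar> + \<bar>?z i\<bar>"
              by (auto simp: abs_triangle_ineq)
          qed
          also have "\<dots> = asum E ?s + asum E ?z" by (rule sum.distrib)
          also have "\<dots> \<le> c E"
            by (rule K[THEN spec, THEN mp, THEN mp, THEN bspec, THEN spec, THEN mp, OF z0 z FE])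
          finally show "asum E (\<lambda>i. (a(n := d)) (idx i) * \<beta> i) \<le> c E" .
        qed
        then show False using a(3) d by blast
      qed
      then show "\<exists>\<eta>>0. \<exists>K. \<forall>n\<ge>K. \<forall>d\<in>D. d > a n \<longrightarrow>
        (\<exists>F\<in>\<F>. asum F (\<lambda>i. if idx i = n then (d - a n) * \<beta> i else 0) > \<eta>)"
        using \<eta> by blast
    qed
  qed
qed

text \<open>With \<open>D = {0..}\<close> a late block can be increased by exactly
  \<open>\<eta>\<close>. Since blocks have norm at most 1, this adds norm at most
  \<open>\<eta>\<close>, which the maximal sequence would have allowed had it been in the
  space.\<close>

lemma block_multiplier:
  fixes idx :: "nat \<Rightarrow> nat" and \<beta> :: "nat \<Rightarrow> real"
  assumes precompact: "precompact_family \<F>"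
    and nonzero: "\<And>n. \<exists>i. idx i = n \<and> \<beta> i \<noteq> 0"
    and unit: "\<And>n F. F \<in> \<F> \<Longrightarrow> asum F (\<lambda>i. if idx i = n then \<beta> i else 0) \<le> 1"
  obtains a where "\<forall>n. 0 \<le> a n" "\<forall>F\<in>\<F>. asum F (\<lambda>i. a (idx i) * \<beta> i) \<le> 1"
    "(\<lambda>i. a (idx i) * \<beta> i) \<notin> X"
proof -
  obtain a where a: "\<forall>n. a n \<in> {0..}" "\<forall>F\<in>\<F>. asum F (\<lambda>i. a (idx i) * \<beta> i) \<le> 1"
    and max: "(\<lambda>i. a (idx i) * \<beta> i) \<in> X \<longrightarrow> (\<exists>\<eta>>0. \<exists>K. \<forall>n\<ge>K. \<forall>d\<in>{0..}. d > a n \<longrightarrow>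
      (\<exists>F\<in>\<F>. asum F (\<lambda>i. if idx i = n then (d - a n) * \<beta> i else 0) > \<eta>))"
    by (rule maximal_multiplier[where D = "{0..}" and r = 1, OF precompact _ _ _ _ nonzero]) simp_all
  have "(\<lambda>i. a (idx i) * \<beta> i) \<notin> X"
  proof
    assume "(\<lambda>i. a (idx i) * \<beta> i) \<in> X"
    then obtain \<eta> K where \<eta>: "\<eta> > 0" "\<And>d. d \<in> {0..} \<Longrightarrow> d > a K \<Longrightarrow>
        \<exists>F\<in>\<F>. asum F (\<lambda>i. if idx i = K then (d - a K) * \<beta> i else 0) > \<eta>"
      using max by blast
    have "a K + \<eta> \<in> {0..}" using spec[OF a(1), of K] \<eta>(1) by simp
    then obtain F where F: "F \<in> \<F>" "asum F (\<lambda>i. if idx i = K then \<eta> * \<beta> i else 0) > \<eta>"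
      using \<eta>(2)[of "a K + \<eta>"] \<eta>(1) by (auto cong: if_cong)
    have "asum F (\<lambda>i. if idx i = K then \<eta> * \<beta> i else 0) =
        \<eta> * asum F (\<lambda>i. if idx i = K then \<beta> i else 0)"
      using \<eta>(1) unfolding sum_distrib_left by (intro sum.cong) (auto simp: abs_mult)
    also have "\<dots> \<le> \<eta>" using unit[OF F(1), of K] \<eta>(1) by simp
    finally show False using F(2) by simp
  qed
  then show thesis using that a by auto
qed

end

section \<open>Copies of the classical sequence spaces\<close>

text \<open>Equivalence with the unit vector basis of c0, phrased through finite sums only, so that
  no convergence or completeness enters and any two-sided estimate transports it. The arbitrary
  bound \<open>B\<close> stands for a maximum, which would be undefined for
  \<open>m = 0\<close>.\<close>

definition c0_like :: "('a::real_vector \<Rightarrow> real) \<Rightarrow> (nat \<Rightarrow> 'a) \<Rightarrow> bool" where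
  "c0_like N z \<longleftrightarrow> (\<exists>c>0. \<exists>C>0. \<forall>t :: nat \<Rightarrow> real. \<forall>m.
     (\<forall>j<m. c * \<bar>t j\<bar> \<le> N (\<Sum>j<m. t j *\<^sub>R z j)) \<and>
     (\<forall>B\<ge>0. (\<forall>j<m. \<bar>t j\<bar> \<le> B) \<longrightarrow> N (\<Sum>j<m. t j *\<^sub>R z j) \<le> C * B))"

lemma c0_like_compare:
  fixes z :: "nat \<Rightarrow> 'a::real_vector" and z' :: "nat \<Rightarrow> 'b::real_vector"
  assumes z: "c0_like N z" and C: "C > 0" and D: "D > 0"
    and up: "\<And>(t :: nat \<Rightarrow> real) m. N' (\<Sum>j<m. t j *\<^sub>R z' j) \<le> C * N (\<Sum>j<m. t j *\<^sub>R z j)"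
    and low: "\<And>(t :: nat \<Rightarrow> real) m. N (\<Sum>j<m. t j *\<^sub>R z j) \<le> D * N' (\<Sum>j<m. t j *\<^sub>R z' j)"
  shows "c0_like N' z'"
proof -
  obtain c C' where c: "c > 0" "C' > 0"
    and *: "\<forall>t m. (\<forall>j<m. c * \<bar>t j\<bar> \<le> N (\<Sum>j<m. t j *\<^sub>R z j)) \<and>
     (\<forall>B\<ge>0. (\<forall>j<m. \<bar>t j\<bar> \<le> B) \<longrightarrow> N (\<Sum>j<m. t j *\<^sub>R z j) \<le> C' * B)"
    using z unfolding c0_like_def by auto
  show ?thesis
    unfolding c0_like_def
  proof (intro exI conjI allI impI)
    show "c / D > 0" "C * C' > 0" using c C D by simp_all
    fix t :: "nat \<Rightarrow> real" and m :: nat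
    { fix j assume "j < m"
      then have "c * \<bar>t j\<bar> \<le> D * N' (\<Sum>j<m. t j *\<^sub>R z' j)" using * low[of t m] by (meson order_trans)
      then show "c / D * \<bar>t j\<bar> \<le> N' (\<Sum>j<m. t j *\<^sub>R z' j)" using D by (simp add: field_simps) }
    fix B :: real assume "0 \<le> B" "\<forall>j<m. \<bar>t j\<bar> \<le> B"
    then have "N (\<Sum>j<m. t j *\<^sub>R z j) \<le> C' * B" using * by blast
    then have "C * N (\<Sum>j<m. t j *\<^sub>R z j) \<le> C * (C' * B)" using C by simp
    then show "N' (\<Sum>j<m. t j *\<^sub>R z' j) \<le> C * C' * B" using up[of t m] by simp
  qed
qed

lemma linear_on_set_sum:
  assumes T: "linear_on_set Z T" and Z: "subspace Z" and w: "\<And>j. j \<in> A \<Longrightarrow> w j \<in> Z"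
  shows "T (\<Sum>j\<in>A. t j *\<^sub>R w j) = (\<Sum>j\<in>A. t j *\<^sub>R T (w j))"
proof -
  have "T (0 *\<^sub>R 0) = 0 *\<^sub>R T 0" using T subspace_0[OF Z] unfolding linear_on_set_def by blast
  then have 0: "T 0 = 0" by simp
  show ?thesis
    using w
  proof (induction A rule: infinite_finite_induct)
    case (insert k A)
    have "T (t k *\<^sub>R w k + (\<Sum>j\<in>A. t j *\<^sub>R w j)) = t k *\<^sub>R T (w k) + T (\<Sum>j\<in>A. t j *\<^sub>R w j)"
      using insert.prems T Z unfolding linear_on_set_def
      by (simp add: subspace_scale subspace_sum)
    then show ?case using insert by (simp only: sum.insert[OF insert.hyps]) simp
  qed (use 0 in simp_all)
qed

lemma linear_on_set_diff:
  assumes "linear_on_set Z T" "subspace Z" "x \<in> Z" "y \<in> Z"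
  shows "T (x - y) = T x - T y"
proof -
  have "T (x - y) + T y = T (x - y + y)"
    using assms unfolding linear_on_set_def by (metis subspace_diff)
  then show ?thesis by (simp add: algebra_simps)
qed

lemma contains_copyI:
  assumes Z: "subspace Z" and T: "linear_on_set Z T" and TX: "T ` Z \<subseteq> X"
    and c: "c > 0" "\<And>z. z \<in> Z \<Longrightarrow> c * M z \<le> N (T z)" "\<And>z. z \<in> Z \<Longrightarrow> N (T z) \<le> C * M z"
    and M: "\<And>z. z \<in> Z \<Longrightarrow> M z \<le> 0 \<Longrightarrow> z = 0" and N: "N 0 = 0"
  shows "contains_copy X N Z M"
proof -
  have add: "T (x + y) = T x + T y" if "x \<in> Z" "y \<in> Z" for x y
    using T that unfolding linear_on_set_def by blast
  have scale: "T (r *\<^sub>R x) = r *\<^sub>R T x" if "x \<in> Z" for r x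
    using T that unfolding linear_on_set_def by blast
  have inj: "inj_on T Z"
  proof (rule inj_onI)
    fix x y assume xy: "x \<in> Z" "y \<in> Z" "T x = T y"
    have d: "x - y \<in> Z" using Z xy(1,2) by (rule subspace_diff)
    have "T (x - y) = 0" using linear_on_set_diff[OF T Z xy(1,2)] xy(3) by simp
    then have "c * M (x - y) \<le> 0" using c(2)[OF d] N by simp
    then have "x - y = 0" using c(1) by (intro M[OF d]) (simp add: mult_le_0_iff)
    then show "x = y" by simp
  qed
  have inv: "inv_into Z T (T z) = z" if "z \<in> Z" for z using inj that by (rule inv_into_f_f)
  have W: "subspace (T ` Z)"
    unfolding subspace_def
  proof (intro conjI ballI allI)
    show "0 \<in> T ` Z" using scale[OF subspace_0[OF Z], of 0] subspace_0[OF Z] by (auto simp: image_iff)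
    fix x assume "x \<in> T ` Z"
    then obtain x' where x': "x = T x'" "x' \<in> Z" by blast
    { fix y assume "y \<in> T ` Z"
      then obtain y' where "y = T y'" "y' \<in> Z" by blast
      then show "x + y \<in> T ` Z" using x' add[of x' y'] subspace_add[OF Z] by (metis imageI) }
    fix r show "r *\<^sub>R x \<in> T ` Z" using x' scale[of x' r] subspace_scale[OF Z] by (metis imageI)
  qed
  have "linear_on_set (T ` Z) (inv_into Z T)"
    unfolding linear_on_set_def
  proof (intro conjI ballI allI)
    fix x assume "x \<in> T ` Z"
    then obtain x' where x': "x = T x'" "x' \<in> Z" by blast
    { fix y assume "y \<in> T ` Z"
      then obtain y' where "y = T y'" "y' \<in> Z" by blast
      then show "inv_into Z T (x + y) = inv_into Z T x + inv_into Z T y"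
        using x' add[of x' y'] subspace_add[OF Z] inv by metis }
    fix r show "inv_into Z T (r *\<^sub>R x) = r *\<^sub>R inv_into Z T x"
      using x' scale[of x' r] subspace_scale[OF Z] inv by metis
  qed
  moreover have "\<forall>w\<in>T ` Z. M (inv_into Z T w) \<le> (1/c) * N w"
    using c(1,2) inv by (auto simp: field_simps)
  ultimately have "bounded_linear_on_set (T ` Z) N M (inv_into Z T)"
    unfolding bounded_linear_on_set_def by blast
  moreover have "bounded_linear_on_set Z M N T"
    unfolding bounded_linear_on_set_def using T c(3) by blast
  ultimately have "isomorphism Z M (T ` Z) N T"
    unfolding isomorphism_def using inj by (simp add: inj_on_imp_bij_betw)
  then show ?thesis unfolding contains_copy_def using W TX by blast
qed

lemma contains_copyD:
  assumes "contains_copy X N Z M"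
  obtains T C D where "subspace (T ` Z)" "T ` Z \<subseteq> X" "linear_on_set Z T"
    "\<forall>z\<in>Z. N (T z) \<le> C * M z" "\<forall>z\<in>Z. M z \<le> D * N (T z)"
proof -
  obtain W T where W: "subspace W" "W \<subseteq> X" and iso: "isomorphism Z M W N T"
    using assms unfolding contains_copy_def by blast
  have bij: "bij_betw T Z W" and T: "linear_on_set Z T"
    using iso unfolding isomorphism_def bounded_linear_on_set_def by simp_all
  obtain C where C: "\<forall>z\<in>Z. N (T z) \<le> C * M z"
    using iso unfolding isomorphism_def bounded_linear_on_set_def by blast
  obtain D where D: "\<forall>w\<in>W. M (inv_into Z T w) \<le> D * N w"
    using iso unfolding isomorphism_def bounded_linear_on_set_def by blast
  have img: "T ` Z = W" using bij by (rule bij_betw_imp_surj_on)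
  have "M z \<le> D * N (T z)" if "z \<in> Z" for z
  proof -
    have "inv_into Z T (T z) = z" using bij that by (metis bij_betw_imp_inj_on inv_into_f_f)
    moreover have "T z \<in> W" using img that by blast
    ultimately show ?thesis using D by metis
  qed
  then show thesis using that[of T C D] W img T C by blast
qed

section \<open>Elementary facts on c0 and l1\<close>

lemma c0_norm_ge:
  assumes "x \<in> c0_space" shows "\<bar>x n\<bar> \<le> c0_norm x"
proof -
  have "convergent x" using assms unfolding c0_space_def convergent_def by blast
  then have "Bseq x" by (rule convergent_imp_Bseq)
  then obtain K where "\<forall>n. norm (x n) \<le> K" unfolding Bseq_def by blast
  then have "bdd_above (range (\<lambda>n. \<bar>x n\<bar>))" by (intro bdd_aboveI[of _ K]) auto
  then show ?thesis unfolding c0_norm_def by (intro cSUP_upper) auto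
qed

lemma c0_norm_le: "(\<And>n. \<bar>x n\<bar> \<le> B) \<Longrightarrow> c0_norm x \<le> B"
  unfolding c0_norm_def by (rule cSUP_least) auto

lemma subspace_c0: "subspace c0_space"
  unfolding subspace_def c0_space_def mem_Collect_eq
proof (intro conjI ballI allI)
  show "0 \<longlonglongrightarrow> (0::real)" by (simp add: zero_fun_def)
  fix x :: "nat \<Rightarrow> real" assume "x \<in> {x. x \<longlonglongrightarrow> 0}"
  then have x: "x \<longlonglongrightarrow> 0" by simp
  show "x + y \<longlonglongrightarrow> 0" if "y \<in> {x. x \<longlonglongrightarrow> 0}" for y
    using tendsto_add_zero[of x sequentially y] x that by (simp add: plus_fun_def)
  show "c *\<^sub>R x \<longlonglongrightarrow> 0" for c
    using tendsto_mult_right_zero[OF x, of c] by (simp add: scaleR_fun_def)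
qed

lemma c0_space_finite_support: "coord_proj {..<m} t \<in> c0_space"
proof -
  have "\<forall>\<^sub>F n in sequentially. coord_proj {..<m} t n = 0"
    using eventually_ge_at_top[of m] by eventually_elim simp
  then show ?thesis unfolding c0_space_def by (simp add: tendsto_eventually del: coord_proj_apply)
qed

lemma c0_like_c0_norm: "c0_like c0_norm unit_vec"
  unfolding c0_like_def sum_unit_vec
proof (intro exI[of _ 1] conjI allI impI)
  fix t :: "nat \<Rightarrow> real" and m
  show "1 * \<bar>t j\<bar> \<le> c0_norm (coord_proj {..<m} t)" if "j < m" for j
    using c0_norm_ge[OF c0_space_finite_support, of m t j] that by simp
  fix B :: real assume "0 \<le> B" "\<forall>j<m. \<bar>t j\<bar> \<le> B"
  then show "c0_norm (coord_proj {..<m} t) \<le> 1 * B" by (auto intro!: c0_norm_le)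
qed simp_all

lemma unit_vec_c0: "unit_vec n \<in> c0_space"
proof -
  have "unit_vec n = coord_proj {..<Suc n} (unit_vec n)" by (auto simp: unit_vec_def)
  then show ?thesis using c0_space_finite_support by metis
qed

lemma l1_norm_nonneg: "x \<in> l1_space \<Longrightarrow> 0 \<le> l1_norm x"
  unfolding l1_space_def l1_norm_def by (simp add: suminf_nonneg)

lemma asum_le_l1_norm: "x \<in> l1_space \<Longrightarrow> finite E \<Longrightarrow> asum E x \<le> l1_norm x"
  unfolding l1_space_def l1_norm_def by (intro sum_le_suminf) auto

lemma l1_norm_le: "x \<in> l1_space \<Longrightarrow> (\<And>n. asum {..<n} x \<le> B) \<Longrightarrow> l1_norm x \<le> B"
  unfolding l1_space_def l1_norm_def by (intro suminf_le_const) auto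

lemma l1_tail:
  assumes "x \<in> l1_space" "\<epsilon> > 0"
  obtains K where "l1_norm x \<le> asum {..<K} x + \<epsilon>"
proof -
  obtain K where K: "\<forall>n\<ge>K. norm (\<Sum>i. \<bar>x (i + n)\<bar>) < \<epsilon>"
    using suminf_exist_split[of \<epsilon> "\<lambda>i. \<bar>x i\<bar>"] assms unfolding l1_space_def by auto
  have "l1_norm x = (\<Sum>i. \<bar>x (i + K)\<bar>) + asum {..<K} x"
    using assms unfolding l1_space_def l1_norm_def
    by (intro suminf_split_initial_segment) simp
  moreover have "(\<Sum>i. \<bar>x (i + K)\<bar>) < \<epsilon>" using K[rule_format, of K] by simp
  ultimately show thesis using that[of K] by simp
qed

lemma subspace_l1: "subspace l1_space"
  unfolding subspace_def
proof (intro conjI ballI allI)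
  show "0 \<in> l1_space" by (simp add: l1_space_def)
  fix x assume x: "x \<in> l1_space"
  show "x + y \<in> l1_space" if "y \<in> l1_space" for y
  proof -
    have "summable (\<lambda>n. \<bar>x n\<bar> + \<bar>y n\<bar>)" using x that unfolding l1_space_def by (simp add: summable_add)
    then show ?thesis unfolding l1_space_def
      by (auto intro: summable_comparison_test' simp: abs_triangle_ineq)
  qed
  fix c show "c *\<^sub>R x \<in> l1_space"
    using x unfolding l1_space_def by (simp add: abs_mult summable_mult)
qed

lemma unit_vec_l1: "unit_vec n \<in> l1_space"
  unfolding l1_space_def mem_Collect_eq
  by (rule summable_finite[of "{n}"]) (auto simp: unit_vec_def)

lemma l1_norm_zero_iff: "x \<in> l1_space \<Longrightarrow> l1_norm x \<le> 0 \<Longrightarrow> x = 0"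
proof
  fix i assume "x \<in> l1_space" "l1_norm x \<le> 0"
  then show "x i = 0 i" using asum_le_l1_norm[of x "{i}"] by simp
qed

text \<open>The coordinates of a sequence equivalent to the basis of \<open>c\<^sub>0\<close> are absolutely summable, so
  late members are almost disjoint from any given vector; adding them one after the other makes
  the norm grow linearly.\<close>

lemma no_c0_in_l1:
  assumes w: "range w \<subseteq> l1_space"
  shows "\<not> c0_like l1_norm w"
proof
  assume "c0_like l1_norm w"
  then obtain c C where c: "c > 0" "C > 0"
    and *: "\<forall>t m. (\<forall>j<m. c * \<bar>t j\<bar> \<le> l1_norm (\<Sum>j<m. t j *\<^sub>R w j)) \<and>
     (\<forall>B\<ge>0. (\<forall>j<m. \<bar>t j\<bar> \<le> B) \<longrightarrow> l1_norm (\<Sum>j<m. t j *\<^sub>R w j) \<le> C * B)"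
    unfolding c0_like_def by auto
  have low: "c * \<bar>t j\<bar> \<le> l1_norm (\<Sum>j<m. t j *\<^sub>R w j)" if "j < m" for t :: "nat \<Rightarrow> real" and j m
    using * that by blast
  have up: "l1_norm (\<Sum>j<m. t j *\<^sub>R w j) \<le> C" if "\<And>j. \<bar>t j\<bar> \<le> 1" for t :: "nat \<Rightarrow> real" and m
    using *[THEN spec, THEN spec, THEN conjunct2, THEN spec, THEN mp, THEN mp, of 1 m t] that by simp
  have l1: "(\<Sum>j<m. t j *\<^sub>R w j) \<in> l1_space" for t :: "nat \<Rightarrow> real" and m
    using w by (intro subspace_sum[OF subspace_l1] subspace_scale[OF subspace_l1]) auto
  have "summable (\<lambda>j. \<bar>w j k\<bar>)" for k
  proof (rule summableI_nonneg_bounded)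
    fix m
    \<comment> \<open>The signs align the \<open>k\<close>-th coordinates, so that their absolute
      values add up inside one vector of norm at most \<open>C\<close>.\<close>
    let ?v = "\<Sum>j<m. sgn (w j k) *\<^sub>R w j"
    have "?v k = (\<Sum>j<m. \<bar>w j k\<bar>)"
      by (simp add: sum_apply abs_sgn mult.commute)
    then have "(\<Sum>j<m. \<bar>w j k\<bar>) \<le> asum {k} ?v" by simp
    also have "\<dots> \<le> l1_norm ?v" by (rule asum_le_l1_norm[OF l1]) simp
    also have "\<dots> \<le> C" by (rule up) (simp add: abs_sgn_eq)
    finally show "(\<Sum>j<m. \<bar>w j k\<bar>) \<le> C" .
  qed simp
  then have "(\<lambda>j. \<bar>w j k\<bar>) \<longlonglongrightarrow> 0" for k by (rule summable_LIMSEQ_zero)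
  then have lim: "(\<lambda>j. asum {..<K} (w j)) \<longlonglongrightarrow> 0" for K by (intro tendsto_null_sum) auto
  \<comment> \<open>A new vector contributes at least \<open>c\<close> by the lower estimate.
    Truncations and overlaps cost five errors of at most \<open>c/8\<close> each, so a gain of
    \<open>c/4\<close> per step is safe, and the sums exceed the fixed bound
    \<open>C\<close>.\<close>
  have "\<exists>t m. (\<forall>j. \<bar>t j\<bar> \<le> (1::real)) \<and> real p * (c/4) \<le> l1_norm (\<Sum>j<m. t j *\<^sub>R w j)" for p
  proof (induction p)
    case 0
    have "real 0 * (c/4) \<le> l1_norm (\<Sum>j<0. 0 *\<^sub>R w j)"
      using l1_norm_nonneg[OF l1, of "\<lambda>_. 0" 0] by (simp only: of_nat_0 mult_zero_left)
    then show ?case by (intro exI[of _ "\<lambda>_. 0"] exI[of _ 0]) (simp only: abs_zero zero_le_one simp_thms)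
  next
    case (Suc p)
    then obtain t m where t: "\<And>j. \<bar>t j\<bar> \<le> (1::real)"
      and le: "real p * (c/4) \<le> l1_norm (\<Sum>j<m. t j *\<^sub>R w j)" by blast
    let ?v = "\<Sum>j<m. t j *\<^sub>R w j"
    obtain K where K: "l1_norm ?v \<le> asum {..<K} ?v + c/8" using l1_tail[OF l1, of "c/8"] c(1) by auto
    have "\<forall>\<^sub>F n in sequentially. asum {..<K} (w n) < c/8"
      using order_tendstoD(2)[OF lim, of "c/8"] c(1) by simp
    then obtain n where n: "n \<ge> m" "asum {..<K} (w n) < c/8"
      unfolding eventually_sequentially by (metis le_cases order_refl)
    define t' where "t' j = (if j < m then t j else if j = n then 1 else 0)" for j
    have "(\<Sum>j<n. t' j *\<^sub>R w j) = ?v"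
      using n(1) by (intro sum.mono_neutral_cong_right) (auto simp: t'_def)
    then have sum: "(\<Sum>j<Suc n. t' j *\<^sub>R w j) = ?v + w n"
      using n(1) by (simp add: t'_def)
    have wn: "w n \<in> l1_space" using w by auto
    have "(\<Sum>j<Suc n. (if j = n then 1 else 0) *\<^sub>R w j) = w n" by (simp add: if_distrib[of "\<lambda>x. x *\<^sub>R _"] cong: if_cong)
    then have "c \<le> l1_norm (w n)" using low[of n "Suc n" "\<lambda>j. if j = n then 1 else 0"] by simp
    have vn: "?v + w n \<in> l1_space" by (intro subspace_add[OF subspace_l1] l1 wn)
    obtain L where L: "l1_norm (w n) \<le> asum {..<L} (w n) + c/8" using l1_tail[OF wn, of "c/8"] c(1) by auto
    have tailv: "asum ({..<L} - {..<K}) ?v \<le> c/8"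
    proof -
      have "asum ({..<K} \<union> ({..<L} - {..<K})) ?v \<le> l1_norm ?v" by (rule asum_le_l1_norm[OF l1]) simp
      also have "asum ({..<K} \<union> ({..<L} - {..<K})) ?v = asum {..<K} ?v + asum ({..<L} - {..<K}) ?v"
        by (rule sum.union_disjoint) auto
      finally show ?thesis using K by linarith
    qed
    have "asum {..<L} (w n) \<le> asum ({..<K} \<union> ({..<L} - {..<K})) (w n)" by (rule sum_mono2) auto
    also have "\<dots> = asum {..<K} (w n) + asum ({..<L} - {..<K}) (w n)"
      by (rule sum.union_disjoint) auto
    finally have tailw: "asum ({..<L} - {..<K}) (w n) \<ge> l1_norm (w n) - c/4" using n(2) L by linarith
    have "asum {..<K} (?v + w n) \<ge> asum {..<K} ?v - asum {..<K} (w n)"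
      unfolding sum_subtractf[symmetric] by (rule sum_mono) simp
    moreover have "asum ({..<L} - {..<K}) (?v + w n) \<ge> asum ({..<L} - {..<K}) (w n) - asum ({..<L} - {..<K}) ?v"
      unfolding sum_subtractf[symmetric] by (rule sum_mono) simp
    moreover have "asum ({..<K} \<union> ({..<L} - {..<K})) (?v + w n) \<le> l1_norm (?v + w n)"
      by (rule asum_le_l1_norm[OF vn]) simp
    moreover have "asum ({..<K} \<union> ({..<L} - {..<K})) (?v + w n) =
        asum {..<K} (?v + w n) + asum ({..<L} - {..<K}) (?v + w n)"
      by (rule sum.union_disjoint) auto
    ultimately have "l1_norm (?v + w n) \<ge> l1_norm ?v + c/4"
      using K n(2) c(1) tailv tailw \<open>c \<le> l1_norm (w n)\<close> by linarith
    then have "real (Suc p) * (c/4) \<le> l1_norm (\<Sum>j<Suc n. t' j *\<^sub>R w j)"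
      using le unfolding sum by (simp add: algebra_simps)
    moreover have "\<forall>j. \<bar>t' j\<bar> \<le> 1" using t by (simp add: t'_def)
    ultimately show ?case by blast
  qed
  then have "real p * (c/4) \<le> C" for p using up by (meson order_trans)
  moreover obtain p where "4 * C / c < real p" using reals_Archimedean2 by blast
  then have "C < real p * (c/4)" using c(1) by (simp add: field_simps)
  ultimately show False by (meson not_le)
qed

section \<open>Copies of \<open>c\<^sub>0\<close>\<close>

text \<open>The half-open intervals between consecutive values of \<open>M\<close> partition the
  naturals, and \<open>idx i\<close> is the number of the interval containing \<open>i\<close>. The
  adjunction form yields both end points of a block when used for \<open>k\<close> and
  \<open>Suc k\<close>.\<close>

lemma block_index:
  fixes M :: "nat \<Rightarrow> nat"
  assumes "strict_mono M" "M 0 = 0"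
  obtains idx where "\<And>k i. k \<le> idx i \<longleftrightarrow> M k \<le> i"
proof -
  define idx where "idx i = (LEAST k. i < M (Suc k))" for i
  have ex: "i < M (Suc i)" for i using seq_suble[OF assms(1), of "Suc i"] by simp
  have "k \<le> idx i \<longleftrightarrow> M k \<le> i" for k i
  proof
    assume k: "k \<le> idx i"
    show "M k \<le> i"
    proof (cases k)
      case 0 then show ?thesis using assms(2) by simp
    next
      case (Suc l)
      then have "l < (LEAST k. i < M (Suc k))" using k by (simp add: idx_def)
      then show ?thesis using not_less_Least[of l "\<lambda>k. i < M (Suc k)"] Suc by simp
    qed
  next
    assume "M k \<le> i"
    moreover have "i < M (Suc (idx i))" unfolding idx_def by (rule LeastI[of "\<lambda>k. i < M (Suc k)"]) (rule ex)
    ultimately have "M k < M (Suc (idx i))" by simp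
    then show "k \<le> idx i" using assms(1) by (simp add: strict_mono_less less_Suc_eq_le)
  qed
  then show thesis by (rule that)
qed

text \<open>Otherwise truncation to the first \<open>n\<close> coordinates would be injective on
  \<open>Y\<close>, and a basis of \<open>Y\<close> would map to an independent set in an
  \<open>n\<close>-dimensional space.\<close>

lemma exists_tail_vector:
  fixes Y :: "(nat \<Rightarrow> real) set"
  assumes Y: "subspace Y" "infinite_dimensional Y"
  obtains y where "y \<in> Y" "y \<noteq> 0" "\<forall>i<n. y i = 0"
proof (rule ccontr)
  assume "\<not> thesis"
  then have none: "y \<in> Y \<Longrightarrow> \<forall>i<n. y i = 0 \<Longrightarrow> y = 0" for y using that by blast
  let ?P = "coord_proj {..<n}"
  have lin: "linear ?P" by (rule linearI) (auto simp: fun_eq_iff)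
  obtain B where B: "B \<subseteq> Y" "independent B" "Y \<subseteq> span B"
    by (rule real_vector.basis_exists)
  have "span B \<subseteq> Y" by (rule span_minimal[OF B(1) Y(1)])
  have inj: "inj_on ?P (span B)"
  proof (rule inj_onI)
    fix x y assume xy: "x \<in> span B" "y \<in> span B" "?P x = ?P y"
    have "x - y \<in> Y" using xy(1,2) \<open>span B \<subseteq> Y\<close> by (meson Y(1) subsetD subspace_diff)
    moreover have "\<forall>i<n. (x - y) i = 0"
    proof (intro allI impI)
      fix i assume "i < n"
      then show "(x - y) i = 0" using fun_cong[OF xy(3), of i] by simp
    qed
    ultimately have "x - y = 0" by (rule none)
    then show "x = y" by simp
  qed
  have "independent (?P ` B)"
    using linear_independent_injective_image[OF lin B(2) inj] .
  moreover have "?P ` B \<subseteq> span (unit_vec ` {..<n})"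
  proof
    fix v assume "v \<in> ?P ` B"
    then obtain b where "v = ?P b" by blast
    then have "v = (\<Sum>k<n. b k *\<^sub>R unit_vec k)" by (simp only: sum_unit_vec)
    then show "v \<in> span (unit_vec ` {..<n})"
      by (simp only:) (intro span_sum span_scale span_base imageI, simp)
  qed
  ultimately have "finite (?P ` B)" using real_vector.independent_span_bound[of "unit_vec ` {..<n}"] by blast
  then have "finite B" by (rule finite_imageD) (rule inj_on_subset[OF inj span_superset])
  then show False using Y(2) B(3) unfolding infinite_dimensional_def by blast
qed

text \<open>The unit vectors are independent and stay so under an injective linear map.\<close>

lemma infinite_dimensional_image:
  assumes Z: "subspace Z" and T: "linear_on_set Z T" and inj: "\<And>z. z \<in> Z \<Longrightarrow> T z = 0 \<Longrightarrow> z = 0"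
    and e: "range unit_vec \<subseteq> Z"
  shows "infinite_dimensional (T ` Z)"
  unfolding infinite_dimensional_def
proof
  assume "\<exists>B. finite B \<and> T ` Z \<subseteq> span B"
  then obtain B where B: "finite B" "T ` Z \<subseteq> span B" by blast
  let ?f = "\<lambda>k. T (unit_vec k)"
  have zero: "t k = 0" if "finite A" "(\<Sum>k\<in>A. t k *\<^sub>R ?f k) = 0" "k \<in> A" for A t k
  proof -
    have "T (\<Sum>k\<in>A. t k *\<^sub>R unit_vec k) = 0"
      using that(2) e by (subst linear_on_set_sum[OF T Z]) auto
    moreover have "(\<Sum>k\<in>A. t k *\<^sub>R unit_vec k) \<in> Z"
      using e by (intro subspace_sum[OF Z] subspace_scale[OF Z]) auto
    ultimately have "(\<Sum>k\<in>A. t k *\<^sub>R unit_vec k) = 0" using inj by blast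
    then have "(\<Sum>k\<in>A. t k *\<^sub>R unit_vec k) k = 0" by simp
    then show ?thesis using that(1,3) by (simp add: sum_apply unit_vec_def if_distrib cong: if_cong)
  qed
  have f: "inj ?f"
  proof (rule injI, rule ccontr)
    fix j k assume jk: "?f j = ?f k" "j \<noteq> k"
    let ?t = "\<lambda>i. if i = j then 1 else - 1 :: real"
    have "(\<Sum>i\<in>{j, k}. ?t i *\<^sub>R ?f i) = 0" using jk by simp
    then have "?t j = 0" by (rule zero[rotated]) simp_all
    then show False by simp
  qed
  have "independent (range ?f)"
    unfolding real_vector.independent_explicit_finite_subsets
  proof (intro allI impI ballI)
    fix S u v assume S: "S \<subseteq> range ?f" "finite S" "(\<Sum>v\<in>S. u v *\<^sub>R v) = 0" "v \<in> S"
    then obtain A where A: "S = ?f ` A" by (meson subset_imageE)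
    have injA: "inj_on ?f A" using f by (rule inj_on_subset) simp
    have "finite A" using S(2) injA unfolding A by (rule finite_imageD)
    obtain k where k: "k \<in> A" "v = ?f k" using S(4) A by blast
    have "(\<Sum>k\<in>A. u (?f k) *\<^sub>R ?f k) = 0"
      using S(3) unfolding A sum.reindex[OF injA] by (simp add: o_def)
    then show "u v = 0" using zero[OF \<open>finite A\<close> _ k(1)] k(2) by simp
  qed
  moreover have "range ?f \<subseteq> span B" using B(2) e by blast
  ultimately have "finite (range ?f)" using real_vector.independent_span_bound[OF B(1)] by blast
  then show False using f by (simp add: finite_image_iff)
qed

context cover_family
begin

text \<open>A gliding hump in \<open>Y\<close> produces vectors that are almost blocks; \<open>block_multiplier\<close> turns these
  blocks into a bounded series that does not converge, and grouping its terms gives the sequence.\<close>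

lemma c0_sequence_in_subspace:
  assumes precompact: "precompact_family \<F>"
    and Y: "subspace Y" "Y \<subseteq> X" "infinite_dimensional Y"
  obtains z where "range z \<subseteq> Y" "\<And>j i. i < j \<Longrightarrow> z j i = 0" "c0_like nrm z"
proof -
  \<comment> \<open>The exponent \<open>k + 2\<close> serves two purposes. The error is at most 1/4,
    so truncated vectors keep norm at least 3/4, and after multiplication by coefficients up to 2
    the errors still sum geometrically.\<close>
  define P where "P k n y m \<longleftrightarrow> y \<in> Y \<and> nrm y = 1 \<and> (\<forall>i<n. y i = 0) \<and> n < m \<and>
      nrm (y - coord_proj {..<m} y) \<le> (1/2) ^ (k + 2)" for k n :: nat and y m
  have "\<exists>y m. P k n y m" for k n
  proof -
    obtain y where y: "y \<in> Y" "y \<noteq> 0" "\<forall>i<n. y i = 0" by (rule exists_tail_vector[OF Y(1,3)])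
    let ?y = "(1 / nrm y) *\<^sub>R y"
    have yX: "y \<in> X" using y(1) Y(2) by blast
    have pos: "nrm y > 0" using norm_eq_0[OF yX] y(2) norm_nonneg[of y] by linarith
    have y': "?y \<in> Y" using Y(1) y(1) by (rule subspace_scale)
    obtain m where m: "\<And>l. l \<ge> m \<Longrightarrow> nrm (?y - coord_proj {..<l} ?y) \<le> (1/2) ^ (k + 2)"
      by (rule tail_norm[OF X_scale[OF yX, of "1 / nrm y"], of "(1/2) ^ (k + 2)"]) auto
    show ?thesis
      unfolding P_def
    proof (intro exI conjI)
      show "?y \<in> Y" by (rule y')
      show "nrm ?y = 1" using pos by (simp add: norm_scale[OF yX])
      show "\<forall>i<n. ?y i = 0" using y(3) by simp
      show "n < max (Suc n) m" by simp
      show "nrm (?y - coord_proj {..<max (Suc n) m} ?y) \<le> (1/2) ^ (k + 2)" by (rule m) simp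
    qed
  qed
  then obtain y' m where ym: "\<And>k n. P k n (y' k n) (m k n)" by metis
  define M where "M = rec_nat 0 m"
  define y where "y k = y' k (M k)" for k
  have M: "M 0 = 0" "M (Suc k) = m k (M k)" for k by (simp_all add: M_def)
  have yY: "y k \<in> Y" and y1: "nrm (y k) = 1" and y0: "i < M k \<Longrightarrow> y k i = 0"
    and ytail: "nrm (y k - coord_proj {..<M (Suc k)} (y k)) \<le> (1/2) ^ (k + 2)" for k i
    using ym[of k "M k"] M by (auto simp: y_def P_def)
  have yX: "y k \<in> X" for k using yY Y(2) by blast
  have mono: "strict_mono M" using ym M by (simp add: strict_mono_Suc_iff P_def)
  obtain idx where idx: "\<And>k i. k \<le> idx i \<longleftrightarrow> M k \<le> i" using block_index[OF mono M(1)] by metis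
  define \<beta> where "\<beta> i = y (idx i) i" for i
  define b where "b k = coord_proj {..<M (Suc k)} (y k)" for k
  have idx_eq: "idx i = k \<longleftrightarrow> M k \<le> i \<and> i < M (Suc k)" for i k
    using idx[of k i] idx[of "Suc k" i] by linarith
  have b: "b k = (\<lambda>i. if idx i = k then \<beta> i else 0)" for k
  proof
    fix i show "b k i = (if idx i = k then \<beta> i else 0)"
      using y0[of i k] idx_eq[of i k] by (auto simp: b_def \<beta>_def)
  qed
  have bX: "b k \<in> X" for k unfolding b_def by (rule coord_proj_X)
  have b_upper: "nrm (b k) \<le> 1" for k
    using norm_mono[OF yX[of k], of "b k"] y1 by (simp add: b_def)
  have b_lower: "nrm (b k) \<ge> 3/4" for k
  proof -
    have "(1/2::real) ^ (k + 2) \<le> (1/2) ^ 2" by (rule power_decreasing) auto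
    then have "nrm (y k - b k) \<le> 1/4" using ytail[of k] by (simp add: b_def power2_eq_square)
    then show ?thesis using norm_diff_triangle[OF yX bX, of k k] y1[of k] by linarith
  qed
  have nonzero: "\<exists>i. idx i = k \<and> \<beta> i \<noteq> 0" for k
  proof (rule ccontr)
    assume "\<not> (\<exists>i. idx i = k \<and> \<beta> i \<noteq> 0)"
    then have "b k = 0" unfolding b by (auto simp: fun_eq_iff)
    then show False using b_lower[of k] by simp
  qed
  have unit: "asum F (\<lambda>i. if idx i = k then \<beta> i else 0) \<le> 1" if "F \<in> \<F>" for k F
  proof -
    have "asum F (\<lambda>i. if idx i = k then \<beta> i else 0) = asum F (b k)" by (simp only: b)
    then show ?thesis using asum_le_norm[OF bX that, of k] b_upper[of k] by linarith
  qed
  obtain a where a: "\<forall>k. 0 \<le> a k" and s1: "\<forall>F\<in>\<F>. asum F (\<lambda>i. a (idx i) * \<beta> i) \<le> 1"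
    and s2: "(\<lambda>i. a (idx i) * \<beta> i) \<notin> X"
    by (rule block_multiplier[OF precompact nonzero unit])
  define s where "s i = a (idx i) * \<beta> i" for i
  have s1: "asum F s \<le> 1" if "F \<in> \<F>" for F using s1 that by (simp add: s_def)
  have sX: "s \<notin> X" using s2 by (simp add: s_def[abs_def])
  have a2: "a k \<le> 2" for k
  proof -
    have "nrm (a k *\<^sub>R b k) \<le> 1"
    proof (rule norm_leI)
      fix F assume "F \<in> \<F>"
      have "asum F (a k *\<^sub>R b k) \<le> asum F s"
        by (rule sum_mono) (simp add: b s_def)
      then show "asum F (a k *\<^sub>R b k) \<le> 1" using s1[OF \<open>F \<in> \<F>\<close>] by simp
    qed simp
    then have "a k * nrm (b k) \<le> 1" using a by (simp add: norm_scale[OF bX])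
    moreover have "a k * (3/4) \<le> a k * nrm (b k)" using a b_lower by (intro mult_left_mono) auto
    ultimately show ?thesis by linarith
  qed
  obtain \<epsilon> where \<epsilon>: "\<epsilon> > 0" "\<And>n. \<exists>F\<in>\<F>. asum (F - {..<n}) s > \<epsilon>"
    using sX unfolding X_iff by (meson not_le)
  \<comment> \<open>A member on which the tail exceeds \<open>\<epsilon>\<close> is finite and is
    exhausted by finitely many blocks. Hence every tail contains a finite group of blocks that is
    already of norm above \<open>\<epsilon>\<close>.\<close>
  have "\<exists>q>p. \<exists>F\<in>\<F>. asum (F \<inter> {M p..<M q}) s > \<epsilon>" for p
  proof -
    obtain F where F: "F \<in> \<F>" "asum (F - {..<M p}) s > \<epsilon>" using \<epsilon>(2) by blast
    obtain q where q: "F \<subseteq> {..<q}" using finite_members[OF F(1)] finite_nat_iff_bounded by blast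
    have "q \<le> M (max (Suc p) q)" using seq_suble[OF mono, of "max (Suc p) q"] by simp
    then have "F \<inter> {M p..<M (max (Suc p) q)} = F - {..<M p}" using q by fastforce
    then have "asum (F \<inter> {M p..<M (max (Suc p) q)}) s > \<epsilon>" using F(2) by (simp only:)
    moreover have "p < max (Suc p) q" by simp
    ultimately show ?thesis using F(1) by blast
  qed
  then obtain q G where q: "\<And>p. p < q p" and G: "\<And>p. G p \<in> \<F>"
    and Gs: "\<And>p. asum (G p \<inter> {M p..<M (q p)}) s > \<epsilon>" by metis
  \<comment> \<open>Starting at block \<open>p0\<close> keeps the total distance between
    \<open>z\<close> and the true blocks \<open>u\<close> within \<open>\<epsilon>/2\<close>, half
    of the lower bound for the groups.\<close>
  obtain p0 where p0: "(1/2::real) ^ p0 < \<epsilon>/2"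
    using real_arch_pow_inv[of "\<epsilon>/2" "1/2"] \<epsilon>(1) by auto
  define p where "p = rec_nat p0 (\<lambda>_. q)"
  have p: "p 0 = p0" "p (Suc j) = q (p j)" for j by (simp_all add: p_def)
  have pmono: "strict_mono p" using q p by (simp add: strict_mono_Suc_iff)
  define u where "u j = coord_proj {M (p j)..<M (p (Suc j))} s" for j
  define z where "z j = (\<Sum>k\<in>{p j..<p (Suc j)}. a k *\<^sub>R y k)" for j
  have u: "u j = (\<Sum>k\<in>{p j..<p (Suc j)}. a k *\<^sub>R b k)" for j
  proof
    fix i
    have "(\<Sum>k\<in>{p j..<p (Suc j)}. a k *\<^sub>R b k) i = (\<Sum>k\<in>{p j..<p (Suc j)}. if idx i = k then s i else 0)"
      unfolding sum_apply by (rule sum.cong) (auto simp: b s_def)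
    also have "\<dots> = (if idx i \<in> {p j..<p (Suc j)} then s i else 0)" by simp
    also have "\<dots> = u j i"
      using idx[of "p j" i] idx[of "p (Suc j)" i] by (auto simp: u_def)
    finally show "u j i = (\<Sum>k\<in>{p j..<p (Suc j)}. a k *\<^sub>R b k) i" ..
  qed
  have uX: "u j \<in> X" for j unfolding u by (intro X_sum X_scale bX)
  have zY: "z j \<in> Y" for j unfolding z_def by (intro subspace_sum[OF Y(1)] subspace_scale[OF Y(1)] yY)
  have zX: "z j \<in> X" for j using zY Y(2) by blast
  have tele: "(\<Sum>k\<in>{l..<n}. (1/2::real) ^ (k + 1)) = (1/2) ^ l - (1/2) ^ n" if "l \<le> n" for l n
    using that by (induction n rule: dec_induct) auto
  have zu: "nrm (z j - u j) \<le> (1/2) ^ p j - (1/2) ^ p (Suc j)" for j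
  proof -
    have "z j - u j = (\<Sum>k\<in>{p j..<p (Suc j)}. a k *\<^sub>R (y k - b k))"
      unfolding z_def u sum_subtractf[symmetric] by (simp add: scaleR_diff_right)
    then have "nrm (z j - u j) \<le> (\<Sum>k\<in>{p j..<p (Suc j)}. nrm (a k *\<^sub>R (y k - b k)))"
      by (simp only:) (intro norm_sum_le X_scale X_diff yX bX)
    also have "\<dots> \<le> (\<Sum>k\<in>{p j..<p (Suc j)}. (1/2) ^ (k + 1))"
    proof (rule sum_mono)
      fix k
      have "nrm (a k *\<^sub>R (y k - b k)) = a k * nrm (y k - b k)"
        using a by (simp add: norm_scale[OF X_diff[OF yX bX]])
      also have "\<dots> \<le> 2 * (1/2) ^ (k + 2)"
        using ytail[of k] a2 a by (intro mult_mono) (auto simp: b_def)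
      finally show "nrm (a k *\<^sub>R (y k - b k)) \<le> (1/2) ^ (k + 1)" by simp
    qed
    also have "\<dots> = (1/2) ^ p j - (1/2) ^ p (Suc j)"
      by (rule tele) (use pmono in \<open>simp add: strict_mono_less_eq\<close>)
    finally show ?thesis .
  qed
  have zu_sum: "(\<Sum>j<m. nrm (z j - u j)) \<le> \<epsilon>/2" for m
  proof -
    have "(\<Sum>j<m. nrm (z j - u j)) \<le> (\<Sum>j<m. (1/2) ^ p j - (1/2) ^ p (Suc j))" by (intro sum_mono zu)
    also have "\<dots> = (1/2) ^ p 0 - (1/2) ^ p m" by (rule sum_lessThan_telescope')
    also have "\<dots> \<le> \<epsilon>/2" using p0 p(1) by (smt (verit) zero_less_power half_gt_zero_iff)
    finally show ?thesis .
  qed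
  \<comment> \<open>The groups occupy disjoint intervals, so their absolute values add up to at most
    those of \<open>s\<close>. The upper c0 estimate thus comes from the bound 1 on the sums of
    \<open>s\<close>.\<close>
  have u_abs: "(\<Sum>j<m. \<bar>u j i\<bar>) = (if M (p 0) \<le> i \<and> i < M (p m) then \<bar>s i\<bar> else 0)" for m i
  proof (induction m)
    case (Suc m)
    have "M (p 0) \<le> M (p m)" "M (p m) \<le> M (p (Suc m))"
      using mono pmono by (simp_all add: strict_mono_less_eq)
    then show ?case using Suc by (auto simp: u_def)
  qed simp
  show thesis
  proof (rule that)
    show "range z \<subseteq> Y" using zY by blast
    show "z j i = 0" if "i < j" for j i
    proof -
      have "y k i = 0" if "k \<in> {p j..<p (Suc j)}" for k
      proof (rule y0)
        have "j \<le> p j" "k \<le> M k" using seq_suble mono pmono by blast+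
        then show "i < M k" using \<open>i < j\<close> that by simp
      qed
      then show ?thesis by (simp add: z_def sum_apply)
    qed
    show "c0_like nrm z"
      unfolding c0_like_def
    proof (intro exI conjI allI impI)
      show "\<epsilon>/2 > 0" "1 + \<epsilon>/2 > 0" using \<epsilon>(1) by simp_all
      fix t :: "nat \<Rightarrow> real" and m :: nat
      let ?Z = "\<Sum>j<m. t j *\<^sub>R z j" and ?U = "\<Sum>j<m. t j *\<^sub>R u j"
      have ZX: "?Z \<in> X" and UX: "?U \<in> X" by (intro X_sum X_scale zX uX)+
      have diff: "nrm (?Z - ?U) \<le> B * (\<epsilon>/2)" if B: "0 \<le> B" "\<forall>j<m. \<bar>t j\<bar> \<le> B" for B
      proof -
        have "?Z - ?U = (\<Sum>j<m. t j *\<^sub>R (z j - u j))"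
          unfolding sum_subtractf[symmetric] by (simp add: scaleR_diff_right)
        then have "nrm (?Z - ?U) \<le> (\<Sum>j<m. nrm (t j *\<^sub>R (z j - u j)))"
          by (simp only:) (intro norm_sum_le X_scale X_diff zX uX)
        also have "\<dots> \<le> (\<Sum>j<m. B * nrm (z j - u j))"
          using B by (intro sum_mono) (auto simp: norm_scale[OF X_diff[OF zX uX]] intro: mult_right_mono)
        also have "\<dots> = B * (\<Sum>j<m. nrm (z j - u j))" by (simp add: sum_distrib_left)
        also have "\<dots> \<le> B * (\<epsilon>/2)" using zu_sum B(1) by (intro mult_left_mono)
        finally show ?thesis .
      qed
      { fix B :: real assume B: "0 \<le> B" "\<forall>j<m. \<bar>t j\<bar> \<le> B"
        have "nrm ?U \<le> B"
        proof (rule norm_leI)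
          fix F assume F: "F \<in> \<F>"
          have "asum F ?U \<le> (\<Sum>i\<in>F. B * \<bar>s i\<bar>)"
          proof (rule sum_mono)
            fix i
            have "\<bar>?U i\<bar> \<le> (\<Sum>j<m. \<bar>t j * u j i\<bar>)" unfolding sum_apply by (simp add: sum_abs)
            also have "\<dots> \<le> (\<Sum>j<m. B * \<bar>u j i\<bar>)"
              using B by (intro sum_mono) (auto simp: abs_mult intro: mult_right_mono)
            also have "\<dots> = B * (\<Sum>j<m. \<bar>u j i\<bar>)" by (simp add: sum_distrib_left)
            also have "\<dots> \<le> B * \<bar>s i\<bar>" using B(1) unfolding u_abs by (intro mult_left_mono) auto
            finally show "\<bar>?U i\<bar> \<le> B * \<bar>s i\<bar>" .
          qed
          also have "\<dots> = B * asum F s" by (simp add: sum_distrib_left)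
          also have "\<dots> \<le> B * 1" using B(1) s1[OF F] by (intro mult_left_mono)
          finally show "asum F ?U \<le> B" by simp
        qed (rule B(1))
        then show "nrm ?Z \<le> (1 + \<epsilon>/2) * B"
          using norm_diff_triangle[OF ZX UX] diff[OF B] by (simp add: algebra_simps) }
      { fix j assume "j < m"
        \<comment> \<open>The distance between \<open>?Z\<close> and \<open>?U\<close> is controlled
          by the largest coefficient. The lower estimate is therefore proved for an index
          \<open>l\<close> attaining it, on a member where only group \<open>l\<close> is visible,
          and then weakened to \<open>j\<close>.\<close>
        then have ne: "(\<lambda>j. \<bar>t j\<bar>) ` {..<m} \<noteq> {}" by auto
        have "Max ((\<lambda>j. \<bar>t j\<bar>) ` {..<m}) \<in> (\<lambda>j. \<bar>t j\<bar>) ` {..<m}" using ne by (intro Max_in) auto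
        then obtain l where l: "l < m" "Max ((\<lambda>j. \<bar>t j\<bar>) ` {..<m}) = \<bar>t l\<bar>" by auto
        then have max: "\<forall>j<m. \<bar>t j\<bar> \<le> \<bar>t l\<bar>" using Max_ge[of "(\<lambda>j. \<bar>t j\<bar>) ` {..<m}"] by auto
        let ?E = "G (p l) \<inter> {M (p l)..<M (q (p l))}"
        have Ui: "?U i = t l * s i" if "i \<in> ?E" for i
        proof -
          have li: "M (p l) \<le> i" "i < M (p (Suc l))" using that p(2) by auto
          have uj: "u j i = (if j = l then s i else 0)" for j
          proof (cases "j = l")
            case False
            consider "Suc j \<le> l" | "Suc l \<le> j" using False by linarith
            then have "M (p (Suc j)) \<le> M (p l) \<or> M (p (Suc l)) \<le> M (p j)"
              using mono pmono by (cases) (simp_all add: strict_mono_less_eq)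
            then show ?thesis using False li by (auto simp: u_def)
          qed (use li in \<open>simp add: u_def\<close>)
          have "(\<Sum>j<m. t j * u j i) = (\<Sum>j<m. if j = l then t l * s i else 0)"
            by (rule sum.cong) (simp_all only: uj split: if_split, simp)
          then show ?thesis using l(1) by (simp add: sum_apply)
        qed
        have "\<bar>t l\<bar> * \<epsilon> \<le> \<bar>t l\<bar> * asum ?E s" using Gs[of "p l"] by (intro mult_left_mono) auto
        also have "\<dots> = asum ?E ?U"
          unfolding sum_distrib_left by (rule sum.cong) (simp_all only: Ui abs_mult)
        also have "\<dots> \<le> nrm ?U" by (rule asum_subset_le_norm[OF UX G]) blast
        also have "\<dots> \<le> nrm ?Z + nrm (?Z - ?U)"
          using norm_diff_triangle[OF UX ZX] by (simp only: norm_minus_commute)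
        also have "\<dots> \<le> nrm ?Z + \<bar>t l\<bar> * (\<epsilon>/2)" using diff[OF _ max] by simp
        finally have "\<epsilon>/2 * \<bar>t l\<bar> \<le> nrm ?Z" by (simp add: algebra_simps)
        moreover have "\<epsilon>/2 * \<bar>t j\<bar> \<le> \<epsilon>/2 * \<bar>t l\<bar>" using max \<open>j < m\<close> \<epsilon>(1) by (intro mult_left_mono) auto
        ultimately show "\<epsilon>/2 * \<bar>t j\<bar> \<le> nrm ?Z" by linarith }
    qed
  qed
qed

text \<open>Since \<open>z j\<close> vanishes below \<open>j\<close>, the infinite combination is a
  finite sum at each coordinate, and \<open>T\<close> is defined without any limit. On a finite
  member the error of a partial sum is again a finite combination, to which the c0 estimate applies;
  closedness of \<open>Y\<close> then receives the limit.\<close>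

lemma contains_c0:
  assumes Y: "subspace Y" "closedin (norm_topology X nrm) Y"
    and z: "range z \<subseteq> Y" "\<And>j i. i < j \<Longrightarrow> z j i = 0" "c0_like nrm z"
  shows "contains_copy Y nrm c0_space c0_norm"
proof -
  have YX: "Y \<subseteq> X" using Y(2) closedin_iff by blast
  obtain c C where c: "c > 0" "C > 0"
    and *: "\<forall>t m. (\<forall>j<m. c * \<bar>t j\<bar> \<le> nrm (\<Sum>j<m. t j *\<^sub>R z j)) \<and>
     (\<forall>B\<ge>0. (\<forall>j<m. \<bar>t j\<bar> \<le> B) \<longrightarrow> nrm (\<Sum>j<m. t j *\<^sub>R z j) \<le> C * B)"
    using z(3) unfolding c0_like_def by auto
  let ?S = "\<lambda>t m. \<Sum>j<m. t j *\<^sub>R z j"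
  define T where "T t = (\<lambda>i. \<Sum>j\<le>i. t j * z j i)" for t
  have SY: "?S t m \<in> Y" for t m
    using z(1) by (intro subspace_sum[OF Y(1)] subspace_scale[OF Y(1)]) auto
  have SX: "?S t m \<in> X" for t m using SY YX by blast
  have TS: "T t i = ?S t m i" if "i < m" for t i m
  proof -
    have "(\<Sum>j\<le>i. t j * z j i) = (\<Sum>j<m. t j * z j i)"
      using that z(2) by (intro sum.mono_neutral_left) auto
    then show ?thesis by (simp add: T_def sum_apply)
  qed
  have tail: "asum F (T t - ?S t m) \<le> C * B" if F: "F \<in> \<F>" and B: "\<forall>j\<ge>m. \<bar>t j\<bar> \<le> B" for F t m B
  proof -
    obtain n where n: "F \<subseteq> {..<n}" using finite_members[OF F] finite_nat_iff_bounded by blast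
    \<comment> \<open>\<open>?t\<close> erases the first \<open>m\<close> coefficients, so the
      difference of two partial sums is a combination whose coefficients are bounded by
      \<open>B\<close>.\<close>
    let ?n = "max m n" and ?t = "\<lambda>j. if j < m then 0 else t j"
    have "?S t ?n - ?S t m = ?S ?t ?n"
    proof -
      have "?S t m = (\<Sum>j<?n. (if j < m then t j else 0) *\<^sub>R z j)"
        by (rule sum.mono_neutral_cong_left) auto
      then show ?thesis by (simp only: sum_subtractf[symmetric]) (rule sum.cong, auto)
    qed
    then have "asum F (T t - ?S t m) = asum F (?S ?t ?n)"
      using n TS[of _ ?n t] by (intro sum.cong) (auto simp: fun_eq_iff)
    also have "\<dots> \<le> nrm (?S ?t ?n)" by (rule asum_le_norm[OF SX F])
    also have "\<dots> \<le> C * B"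
    proof -
      have "0 \<le> B" using B by (meson abs_ge_zero order_refl order_trans)
      moreover have "\<forall>j<?n. \<bar>?t j\<bar> \<le> B" using B \<open>0 \<le> B\<close> by auto
      ultimately show ?thesis
        using *[THEN spec, THEN spec, THEN conjunct2, THEN spec, THEN mp, THEN mp, of B ?n ?t] by simp
    qed
    finally show ?thesis .
  qed
  have small: "\<exists>m. \<forall>j\<ge>m. \<bar>t j\<bar> \<le> B" if "t \<in> c0_space" "B > 0" for t B
  proof -
    have "\<forall>\<^sub>F j in sequentially. \<bar>t j\<bar> < B"
      using that tendsto_rabs_zero[of t sequentially] order_tendstoD(2)[of "\<lambda>j. \<bar>t j\<bar>" 0 sequentially B]
      by (simp add: c0_space_def)
    then show ?thesis unfolding eventually_sequentially by (meson less_imp_le)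
  qed
  have TX: "T t \<in> X" if t: "t \<in> c0_space" for t
  proof (rule X_closed)
    fix \<epsilon> :: real assume "\<epsilon> > 0"
    then obtain m where "\<forall>j\<ge>m. \<bar>t j\<bar> \<le> \<epsilon> / C" using small[OF t, of "\<epsilon>/C"] c(2) by auto
    then have "\<forall>F\<in>\<F>. asum F (T t - ?S t m) \<le> \<epsilon>" using tail[of _ m t "\<epsilon>/C"] c(2) by simp
    then show "\<exists>y\<in>X. \<forall>F\<in>\<F>. asum F (T t - y) \<le> \<epsilon>" using SX by blast
  qed
  have approx: "\<exists>m. \<forall>n\<ge>m. nrm (T t - ?S t n) \<le> \<epsilon>" if t: "t \<in> c0_space" and "\<epsilon> > 0" for t \<epsilon>
  proof -
    obtain m where m: "\<forall>j\<ge>m. \<bar>t j\<bar> \<le> \<epsilon> / C" using small[OF t, of "\<epsilon>/C"] c(2) \<open>\<epsilon> > 0\<close> by auto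
    have "nrm (T t - ?S t n) \<le> \<epsilon>" if "n \<ge> m" for n
    proof (rule norm_leI)
      fix F assume "F \<in> \<F>"
      have "\<forall>j\<ge>n. \<bar>t j\<bar> \<le> \<epsilon> / C" using m that by simp
      then show "asum F (T t - ?S t n) \<le> \<epsilon>" using tail[OF \<open>F \<in> \<F>\<close>, of n t "\<epsilon> / C"] c(2) by simp
    qed (use \<open>\<epsilon> > 0\<close> in simp)
    then show ?thesis by blast
  qed
  have TY: "T t \<in> Y" if t: "t \<in> c0_space" for t
  proof -
    have "\<exists>y\<in>Y. nrm (T t - y) < \<epsilon>" if "\<epsilon> > 0" for \<epsilon>
    proof -
      have "\<exists>m. \<forall>n\<ge>m. nrm (T t - ?S t n) \<le> \<epsilon>/2" by (rule approx[OF t]) (use that in simp)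
      then obtain m where "nrm (T t - ?S t m) \<le> \<epsilon>/2" by blast
      then have "nrm (T t - ?S t m) < \<epsilon>" using that by simp
      then show ?thesis using SY by blast
    qed
    then show ?thesis using Y(2) TX[OF t] unfolding closedin_iff by blast
  qed
  show ?thesis
  proof (rule contains_copyI[OF subspace_c0 _ _ c(1), where C = C])
    show "linear_on_set c0_space T"
      unfolding linear_on_set_def T_def
      by (auto simp: fun_eq_iff algebra_simps sum.distrib sum_distrib_left)
    show "T ` c0_space \<subseteq> Y" using TY by blast
    fix t assume t: "t \<in> c0_space"
    have t0: "0 \<le> c0_norm t" using c0_norm_ge[OF t, of 0] by linarith
    show "nrm (T t) \<le> C * c0_norm t"
    proof (rule norm_leI)
      fix F assume "F \<in> \<F>"
      then show "asum F (T t) \<le> C * c0_norm t" using tail[of F 0 t "c0_norm t"] c0_norm_ge[OF t] by simp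
    qed (use t0 c(2) in simp)
    have "\<bar>t j\<bar> \<le> nrm (T t) / c" for j
    proof -
      have "c * \<bar>t j\<bar> \<le> nrm (T t) + \<epsilon>" if "\<epsilon> > 0" for \<epsilon>
      proof -
        obtain m where m: "\<forall>n\<ge>m. nrm (T t - ?S t n) \<le> \<epsilon>" using approx[OF t \<open>\<epsilon> > 0\<close>] by blast
        let ?n = "max m (Suc j)"
        have "c * \<bar>t j\<bar> \<le> nrm (?S t ?n)"
          using *[THEN spec, THEN spec, THEN conjunct1, THEN spec, THEN mp, of j ?n t] by simp
        also have "\<dots> \<le> nrm (T t) + nrm (T t - ?S t ?n)"
          using norm_diff_triangle[OF SX TX[OF t]] by (simp only: norm_minus_commute)
        also have "\<dots> \<le> nrm (T t) + \<epsilon>" using m by simp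
        finally show ?thesis .
      qed
      then have "c * \<bar>t j\<bar> \<le> nrm (T t)" by (rule field_le_epsilon)
      then show ?thesis using c(1) by (simp add: field_simps)
    qed
    then have "c0_norm t \<le> nrm (T t) / c" by (rule c0_norm_le)
    then show "c * c0_norm t \<le> nrm (T t)" using c(1) by (simp add: field_simps)
  next
    fix t assume t: "t \<in> c0_space" "c0_norm t \<le> 0"
    show "t = 0"
    proof
      fix j show "t j = 0 j" using c0_norm_ge[OF t(1), of j] t(2) by simp
    qed
  qed simp
qed

lemma precompact_imp_c0_saturated:
  assumes "precompact_family \<F>"
  shows "c0_saturated X nrm"
  unfolding c0_saturated_def
proof (intro allI impI, elim conjE)
  fix Y assume Y: "subspace Y" "Y \<subseteq> X" "closedin (norm_topology X nrm) Y" "infinite_dimensional Y"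
  obtain z where z: "range z \<subseteq> Y" "\<And>j i. i < j \<Longrightarrow> z j i = 0" "c0_like nrm z"
    using c0_sequence_in_subspace[OF assms Y(1,2,4)] by metis
  show "contains_copy Y nrm c0_space c0_norm" by (rule contains_c0[OF Y(1,3) z])
qed

text \<open>Both estimates for \<open>T\<close> together pull a c0-like sequence in the image back
  to one in l1.\<close>

lemma l1_image_no_c0:
  assumes T: "linear_on_set l1_space T"
    and C: "\<forall>z\<in>l1_space. nrm (T z) \<le> C * l1_norm z" and D: "\<forall>z\<in>l1_space. l1_norm z \<le> D * nrm (T z)"
    and z: "range z \<subseteq> T ` l1_space"
  shows "\<not> c0_like nrm z"
proof
  assume c0: "c0_like nrm z"
  have "\<forall>j. \<exists>w. w \<in> l1_space \<and> z j = T w" using z by blast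
  then obtain w where w: "\<And>j. w j \<in> l1_space" "\<And>j. z j = T (w j)" by metis
  have l1: "(\<Sum>j<m. t j *\<^sub>R w j) \<in> l1_space" for t :: "nat \<Rightarrow> real" and m
    using w by (intro subspace_sum[OF subspace_l1] subspace_scale[OF subspace_l1]) auto
  have Tsum: "T (\<Sum>j<m. t j *\<^sub>R w j) = (\<Sum>j<m. t j *\<^sub>R z j)" for t :: "nat \<Rightarrow> real" and m
    unfolding w(2) by (rule linear_on_set_sum[OF T subspace_l1]) (rule w(1))
  have "c0_like l1_norm w"
  \<comment> \<open>The constants of an isomorphism are not known to be positive; taking the maximum
    with 1 makes them so.\<close>
  proof (rule c0_like_compare[OF c0, of "max D 1" "max C 1"])
    fix t :: "nat \<Rightarrow> real" and m
    have "l1_norm (\<Sum>j<m. t j *\<^sub>R w j) \<le> D * nrm (\<Sum>j<m. t j *\<^sub>R z j)"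
      using D l1 Tsum by metis
    also have "\<dots> \<le> max D 1 * nrm (\<Sum>j<m. t j *\<^sub>R z j)" by (intro mult_right_mono) auto
    finally show "l1_norm (\<Sum>j<m. t j *\<^sub>R w j) \<le> max D 1 * nrm (\<Sum>j<m. t j *\<^sub>R z j)" .
    have "nrm (\<Sum>j<m. t j *\<^sub>R z j) \<le> C * l1_norm (\<Sum>j<m. t j *\<^sub>R w j)"
      using C l1 Tsum by metis
    also have "\<dots> \<le> max C 1 * l1_norm (\<Sum>j<m. t j *\<^sub>R w j)"
      using l1_norm_nonneg[OF l1] by (intro mult_right_mono) auto
    finally show "nrm (\<Sum>j<m. t j *\<^sub>R z j) \<le> max C 1 * l1_norm (\<Sum>j<m. t j *\<^sub>R w j)" .
  qed auto
  then show False using no_c0_in_l1 w(1) by blast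
qed

text \<open>The gliding hump is run inside the image of l1 itself: a c0-like sequence there already
  gives the contradiction, through finite sums alone.\<close>

lemma precompact_imp_no_l1:
  assumes "precompact_family \<F>"
  shows "\<not> contains_copy X nrm l1_space l1_norm"
proof
  assume "contains_copy X nrm l1_space l1_norm"
  then obtain T C D where W: "subspace (T ` l1_space)" "T ` l1_space \<subseteq> X" and T: "linear_on_set l1_space T"
    and C: "\<forall>z\<in>l1_space. nrm (T z) \<le> C * l1_norm z" and D: "\<forall>z\<in>l1_space. l1_norm z \<le> D * nrm (T z)"
    by (rule contains_copyD)
  have "infinite_dimensional (T ` l1_space)"
  proof (rule infinite_dimensional_image[OF subspace_l1 T])
    fix z assume z: "z \<in> l1_space" "T z = 0"
    then have "l1_norm z \<le> 0" using D by (metis mult_zero_right norm_zero)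
    then show "z = 0" by (rule l1_norm_zero_iff[OF z(1)])
  qed (use unit_vec_l1 in blast)
  then obtain z where z: "range z \<subseteq> T ` l1_space" "c0_like nrm z"
    using c0_sequence_in_subspace[OF assms W] by metis
  then show False using l1_image_no_c0[OF T C D] by blast
qed

end

section \<open>Bounded functionals and copies of \<open>\<ell>\<^sub>1\<close>\<close>

context cover_family
begin

text \<open>Vanishing below \<open>n\<close> is a closed condition because coordinates are
  continuous. The inclusion lets estimates for all vectors vanishing below \<open>n\<close> pass to
  the closed span of the tail.\<close>

lemma closed_span_tail_subset:
  "closed_span X nrm (unit_vec ` {n..}) \<subseteq> {x \<in> X. \<forall>i<n. x i = 0}" (is "_ \<subseteq> ?V")
proof
  fix x assume "x \<in> closed_span X nrm (unit_vec ` {n..})"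
  then have x: "x \<in> norm_topology X nrm closure_of (span (unit_vec ` {n..}))"
    by (simp add: closed_span_def)
  have V: "subspace ?V"
    using subspace_X by (auto simp: subspace_def)
  have sub: "span (unit_vec ` {n..}) \<subseteq> ?V"
    by (rule span_minimal[OF _ V]) (use unit_vec_X in \<open>auto simp: unit_vec_def\<close>)
  have "closedin (norm_topology X nrm) ?V"
    unfolding closedin_iff
  proof (intro conjI ballI impI)
    fix y assume y: "y \<in> X" "\<forall>\<epsilon>>0. \<exists>v\<in>?V. nrm (y - v) < \<epsilon>"
    have "y i = 0" if "i < n" for i
    proof -
      have "\<bar>y i\<bar> \<le> 0 + \<epsilon>" if "\<epsilon> > 0" for \<epsilon>
      proof -
        obtain v where v: "v \<in> ?V" "nrm (y - v) < \<epsilon>" using y(2) \<open>\<epsilon> > 0\<close> by blast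
        then have "\<bar>(y - v) i\<bar> \<le> nrm (y - v)" by (intro abs_le_norm X_diff y(1)) simp
        then show ?thesis using v \<open>i < n\<close> by simp
      qed
      then have "\<bar>y i\<bar> \<le> 0" by (rule field_le_epsilon)
      then show ?thesis by simp
    qed
    then show "y \<in> ?V" using y(1) by simp
  qed blast
  then show "x \<in> ?V" by (rule closure_ofD[OF x sub])
qed

lemma subset_closed_span:
  assumes "B \<subseteq> X" shows "span B \<subseteq> closed_span X nrm B"
proof -
  interpret M: Metric_space X "\<lambda>x y. nrm (x - y)" by (rule Metric_space_X)
  have "span B \<subseteq> X" by (rule span_minimal[OF assms subspace_X])
  then show ?thesis
    unfolding closed_span_def norm_topology_def by (intro closure_of_subset) simp
qed

text \<open>Otherwise there are successive blocks of norm at most 1 on which \<open>f\<close>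
  exceeds \<open>\<delta>/2\<close>. For the multipliers of \<open>block_multiplier\<close>,
  boundedness of \<open>f\<close> on the partial sums forces \<open>a\<close> to be summable. Then
  the series converges absolutely, and its sum lies in the space after all.\<close>

lemma functional_small_on_tails:
  assumes precompact: "precompact_family \<F>"
    and f: "linear_on_set X f" "\<And>x. x \<in> X \<Longrightarrow> \<bar>f x\<bar> \<le> C * nrm x"
    and "\<delta> > (0::real)"
  shows "\<exists>n. \<forall>x\<in>X. (\<forall>i<n. x i = 0) \<longrightarrow> nrm x \<le> 1 \<longrightarrow> \<bar>f x\<bar> \<le> \<delta>"
proof (rule ccontr)
  assume contra: "\<not> ?thesis"
  have f0: "f 0 = 0"
    using linear_on_set_sum[OF f(1) subspace_X, of "{}"] by simp
  have fneg: "f (- x) = - f x" if "x \<in> X" for x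
    using linear_on_set_diff[OF f(1) subspace_X zero_X that] f0 by simp
  define P where "P n y m \<longleftrightarrow> n < m \<and> y \<in> X \<and> nrm y \<le> 1 \<and> f y > \<delta>/2 \<and>
      (\<forall>i. y i \<noteq> 0 \<longrightarrow> n \<le> i \<and> i < m)" for n m :: nat and y
  have "\<exists>y m. P n y m" for n
  proof -
    obtain x where x: "x \<in> X" "\<forall>i<n. x i = 0" "nrm x \<le> 1" "\<bar>f x\<bar> > \<delta>"
      using contra by (meson not_le)
    define x' where "x' = (if f x > 0 then x else - x)"
    have x': "x' \<in> X" "\<forall>i<n. x' i = 0" "nrm x' \<le> 1" "f x' > \<delta>"
      using x \<open>\<delta> > 0\<close> fneg[OF x(1)] subspace_neg[OF subspace_X x(1)] by (auto simp: x'_def)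
    \<comment> \<open>Truncation with this error changes \<open>f\<close> by at most
      \<open>\<delta>/2\<close>. The summand 1 avoids division by 0, and the absolute value allows
      for a negative \<open>C\<close>.\<close>
    have "\<delta> / (2 * (\<bar>C\<bar> + 1)) > 0" using \<open>\<delta> > 0\<close> by simp
    then obtain m where m: "\<And>l. l \<ge> m \<Longrightarrow> nrm (x' - coord_proj {..<l} x') \<le> \<delta> / (2 * (\<bar>C\<bar> + 1))"
      by (rule tail_norm[OF x'(1)]) blast
    let ?m = "max (Suc n) m"
    let ?y = "coord_proj {..<?m} x'"
    have yX: "?y \<in> X" by (rule coord_proj_X)
    have "\<bar>f (x' - ?y)\<bar> \<le> C * nrm (x' - ?y)" by (intro f(2) X_diff x' yX)
    also have "\<dots> \<le> (\<bar>C\<bar> + 1) * nrm (x' - ?y)" by (intro mult_right_mono) auto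
    also have "\<dots> \<le> (\<bar>C\<bar> + 1) * (\<delta> / (2 * (\<bar>C\<bar> + 1)))" by (intro mult_left_mono m) auto
    also have "\<dots> = \<delta>/2" by (simp add: field_simps)
    finally have "f ?y > \<delta>/2"
      using linear_on_set_diff[OF f(1) subspace_X x'(1) yX] x'(4) by linarith
    moreover have "nrm ?y \<le> nrm x'" by (rule norm_mono[OF x'(1)]) simp
    then have "nrm ?y \<le> 1" using x'(3) by linarith
    moreover have "n \<le> i \<and> i < ?m" if "?y i \<noteq> 0" for i
      using that x'(2) by (cases "i < n") (auto split: if_splits)
    ultimately have "P n ?y ?m" using yX unfolding P_def by auto
    then show ?thesis by blast
  qed
  then obtain y' m where ym: "\<And>n. P n (y' n) (m n)" by metis
  define M where "M = rec_nat 0 (\<lambda>_. m)"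
  define y where "y k = y' (M k)" for k
  have M: "M 0 = 0" "M (Suc k) = m (M k)" for k by (simp_all add: M_def)
  have yX: "y k \<in> X" and y1: "nrm (y k) \<le> 1" and fy: "f (y k) > \<delta>/2"
    and y0: "y k i \<noteq> 0 \<Longrightarrow> M k \<le> i \<and> i < M (Suc k)" for k i
    using ym[of "M k"] M by (auto simp: y_def P_def)
  have mono: "strict_mono M" using ym M by (simp add: strict_mono_Suc_iff P_def)
  obtain idx where idx: "\<And>k i. k \<le> idx i \<longleftrightarrow> M k \<le> i" using block_index[OF mono M(1)] by metis
  define \<beta> where "\<beta> i = y (idx i) i" for i
  have idx_eq: "idx i = k \<longleftrightarrow> M k \<le> i \<and> i < M (Suc k)" for i k
    using idx[of k i] idx[of "Suc k" i] by linarith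
  have y: "y k = (\<lambda>i. if idx i = k then \<beta> i else 0)" for k
  proof
    fix i show "y k i = (if idx i = k then \<beta> i else 0)"
      using y0[of k i] idx_eq[of i k] by (auto simp: \<beta>_def)
  qed
  have nonzero: "\<exists>i. idx i = k \<and> \<beta> i \<noteq> 0" for k
  proof (rule ccontr)
    assume "\<not> (\<exists>i. idx i = k \<and> \<beta> i \<noteq> 0)"
    then have "y k = 0" unfolding y by (auto simp: fun_eq_iff)
    then show False using fy[of k] f0 \<open>\<delta> > 0\<close> by simp
  qed
  have unit: "asum F (\<lambda>i. if idx i = k then \<beta> i else 0) \<le> 1" if "F \<in> \<F>" for k F
  proof -
    have "asum F (\<lambda>i. if idx i = k then \<beta> i else 0) = asum F (y k)" by (simp only: y)
    then show ?thesis using asum_le_norm[OF yX that, of k] y1[of k] by linarith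
  qed
  obtain a where a: "\<forall>k. 0 \<le> a k" and s1: "\<forall>F\<in>\<F>. asum F (\<lambda>i. a (idx i) * \<beta> i) \<le> 1"
    and s2: "(\<lambda>i. a (idx i) * \<beta> i) \<notin> X"
    by (rule block_multiplier[OF precompact nonzero unit])
  define s where "s i = a (idx i) * \<beta> i" for i
  have s1: "asum F s \<le> 1" if "F \<in> \<F>" for F using s1 that by (simp add: s_def)
  have sX: "s \<notin> X" using s2 by (simp add: s_def[abs_def])
  have partial: "(\<Sum>k<n. a k *\<^sub>R y k) = coord_proj {..<M n} s" for n
  proof
    fix i
    have "(\<Sum>k<n. a k *\<^sub>R y k) i = (\<Sum>k<n. if idx i = k then s i else 0)"
      unfolding sum_apply by (rule sum.cong) (auto simp: y s_def)
    also have "\<dots> = coord_proj {..<M n} s i" using idx[of n i] by auto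
    finally show "(\<Sum>k<n. a k *\<^sub>R y k) i = coord_proj {..<M n} s i" .
  qed
  have "summable a"
  proof (rule summableI_nonneg_bounded)
    show "0 \<le> a k" for k using a by blast
    fix n
    let ?s = "\<Sum>k<n. a k *\<^sub>R y k"
    have "nrm ?s \<le> 1"
    proof (rule norm_leI)
      fix F assume "F \<in> \<F>"
      have "asum F ?s \<le> asum F s" unfolding partial by (rule sum_mono) simp
      then show "asum F ?s \<le> 1" using s1[OF \<open>F \<in> \<F>\<close>] by simp
    qed simp
    have "(\<Sum>k<n. a k) * (\<delta>/2) = (\<Sum>k<n. a k * (\<delta>/2))" by (rule sum_distrib_right)
    also have "\<dots> \<le> (\<Sum>k<n. a k * f (y k))"
      using a fy by (intro sum_mono mult_left_mono) (auto simp: less_imp_le)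
    also have "\<dots> = f ?s" using linear_on_set_sum[OF f(1) subspace_X, of "{..<n}" y a] yX by simp
    also have "\<dots> \<le> C * nrm ?s" using f(2)[of ?s] X_sum[OF X_scale[OF yX]] by fastforce
    also have "\<dots> \<le> \<bar>C\<bar> * 1" using \<open>nrm ?s \<le> 1\<close> by (intro mult_mono) auto
    finally show "(\<Sum>k<n. a k) \<le> 2 * \<bar>C\<bar> / \<delta>" using \<open>\<delta> > 0\<close> by (simp add: field_simps)
  qed
  have "s \<in> X"
  proof (rule X_closed)
    fix \<epsilon> :: real assume "\<epsilon> > 0"
    then obtain l where l: "\<forall>m\<ge>l. \<forall>n. norm (\<Sum>k\<in>{m..<n}. a k) < \<epsilon>"
      using \<open>summable a\<close> unfolding summable_Cauchy by blast
    let ?s = "\<lambda>n. \<Sum>k<n. a k *\<^sub>R y k"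
    have sumX: "(\<Sum>k\<in>A. a k *\<^sub>R y k) \<in> X" for A by (intro X_sum X_scale yX)
    have "asum F (s - ?s l) \<le> \<epsilon>" if F: "F \<in> \<F>" for F
    proof -
      obtain n where n: "F \<subseteq> {..<n}" using finite_members[OF F] finite_nat_iff_bounded by blast
      let ?n = "max l n"
      let ?d = "\<Sum>k\<in>{l..<?n}. a k *\<^sub>R y k"
      have "?s ?n = ?s l + ?d"
        using sum.atLeastLessThan_concat[of 0 l ?n "\<lambda>k. a k *\<^sub>R y k"] by (simp add: atLeast0LessThan)
      have "s i = ?s ?n i" if "i \<in> F" for i
      proof -
        have "i < ?n" using n that by auto
        also have "?n \<le> M ?n" using seq_suble[OF mono] .
        finally show ?thesis by (simp add: partial)
      qed
      then have "asum F (s - ?s l) = asum F ?d"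
        using \<open>?s ?n = ?s l + ?d\<close> by (intro sum.cong) auto
      also have "\<dots> \<le> nrm ?d" by (rule asum_le_norm[OF sumX F])
      also have "\<dots> \<le> (\<Sum>k\<in>{l..<?n}. nrm (a k *\<^sub>R y k))" by (intro norm_sum_le X_scale yX)
      also have "\<dots> \<le> (\<Sum>k\<in>{l..<?n}. a k)"
        using a y1 by (intro sum_mono) (simp add: norm_scale[OF yX] mult_left_le)
      also have "\<dots> \<le> \<epsilon>" using l[rule_format, of l ?n] by simp
      finally show ?thesis .
    qed
    then show "\<exists>x\<in>X. \<forall>F\<in>\<F>. asum F (s - x) \<le> \<epsilon>" using sumX[of "{..<l}"] by blast
  qed
  then show False using sX by contradiction
qed

lemma precompact_imp_shrinking:
  assumes "precompact_family \<F>"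
  shows "shrinking_basis X nrm unit_vec"
  unfolding shrinking_basis_def
proof (intro conjI allI impI schauder_basis_unit_vec)
  fix f assume "bounded_linear_on_set X nrm abs f"
  then obtain C where f: "linear_on_set X f" "\<And>x. x \<in> X \<Longrightarrow> \<bar>f x\<bar> \<le> C * nrm x"
    unfolding bounded_linear_on_set_def by blast
  let ?V = "\<lambda>n. {x \<in> closed_span X nrm (unit_vec ` {n..}). nrm x \<le> 1}"
  \<comment> \<open>\<open>functional_norm\<close> is a supremum of reals, hence informative only
    over a nonempty set with bounded values; the zero vector gives nonemptiness and the lower bound
    0.\<close>
  have zero: "0 \<in> ?V n" for n
    using subset_closed_span[of "unit_vec ` {n..}"] unit_vec_X span_zero by auto
  show "(\<lambda>n. functional_norm (closed_span X nrm (unit_vec ` {n..})) nrm f) \<longlonglongrightarrow> 0"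
  proof (rule LIMSEQ_I)
    fix r :: real assume "r > 0"
    then obtain n where n: "\<And>x. x \<in> X \<Longrightarrow> \<forall>i<n. x i = 0 \<Longrightarrow> nrm x \<le> 1 \<Longrightarrow> \<bar>f x\<bar> \<le> r/2"
      using functional_small_on_tails[OF assms f, of "r/2"] half_gt_zero by blast
    have "norm (functional_norm (closed_span X nrm (unit_vec ` {m..})) nrm f - 0) < r" if "m \<ge> n" for m
    proof -
      have le: "\<bar>f x\<bar> \<le> r/2" if "x \<in> ?V m" for x
        using closed_span_tail_subset[of m] that \<open>m \<ge> n\<close> by (intro n) auto
      have "?V m \<noteq> {}" using zero by blast
      then have "(SUP x\<in>?V m. \<bar>f x\<bar>) \<le> r/2" by (rule cSUP_least) (rule le)
      moreover have "\<bar>f 0\<bar> \<le> (SUP x\<in>?V m. \<bar>f x\<bar>)"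
        by (intro cSUP_upper zero bdd_aboveI[of _ "r/2"]) (use le in blast)
      ultimately show ?thesis using \<open>r > 0\<close> by (simp add: functional_norm_def)
    qed
    then show "\<exists>no. \<forall>n\<ge>no. norm (functional_norm (closed_span X nrm (unit_vec ` {n..})) nrm f - 0) < r"
      by blast
  qed
qed

end

section \<open>Failure of precompactness: l1 on an infinite limit set\<close>

locale infinite_limit_set = cover_family +
  fixes A :: "nat set"
  assumes infinite: "infinite A"
    and limit: "\<And>n. \<exists>F\<in>\<F>. F \<inter> {..<n} = A \<inter> {..<n}"
begin

abbreviation e :: "nat \<Rightarrow> nat" where "e \<equiv> enumerate A"

lemma e_mono: "strict_mono e" and e_range: "range e = A" and e_inj: "inj e"
  using infinite by (auto simp: strict_mono_enumerate range_enumerate strict_mono_imp_inj_on)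

lemma initial_segment: "\<exists>F\<in>\<F>. e ` {..<m} \<subseteq> F"
proof -
  obtain F where F: "F \<in> \<F>" "F \<inter> {..<e m} = A \<inter> {..<e m}" using limit by blast
  have "e k \<in> F" if "k < m" for k
  proof -
    have "e k \<in> A \<inter> {..<e m}" using that e_range e_mono by (auto simp: strict_mono_less)
    then show ?thesis using F(2) by blast
  qed
  then show ?thesis using F(1) by blast
qed

definition embed :: "(nat \<Rightarrow> real) \<Rightarrow> nat \<Rightarrow> real" where
  "embed t i = (if i \<in> A then t (inv e i) else 0)"

lemma embed_e [simp]: "embed t (e k) = t k"
  using e_range e_inj by (auto simp: embed_def)

lemma asum_embed: "finite E \<Longrightarrow> asum E (embed t) = asum (e -` E) t"
proof -
  assume "finite E"
  have img: "e ` (e -` E) = E \<inter> A" using e_range by auto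
  have "asum E (embed t) = asum (e ` (e -` E)) (embed t)"
    unfolding img using \<open>finite E\<close> by (intro sum.mono_neutral_right) (auto simp: embed_def)
  also have "\<dots> = asum (e -` E) t"
    by (subst sum.reindex[OF inj_on_subset[OF e_inj]]) (auto simp: o_def)
  finally show ?thesis .
qed

lemma finite_vimage_e: "finite E \<Longrightarrow> finite (e -` E)"
  by (rule finite_vimageI[OF _ e_inj])

lemma embed_X:
  assumes t: "t \<in> l1_space" shows "embed t \<in> X"
  unfolding X_iff
proof (intro allI impI)
  fix \<epsilon> :: real assume "\<epsilon> > 0"
  then obtain K where K: "l1_norm t \<le> asum {..<K} t + \<epsilon>" using l1_tail[OF t] by blast
  have "asum (F - {..<e K}) (embed t) \<le> \<epsilon>" if "F \<in> \<F>" for F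
  proof -
    let ?S = "e -` (F - {..<e K})"
    have fin: "finite ?S" using finite_members[OF that] by (intro finite_vimage_e) simp
    have "asum {..<K} t + asum ?S t = asum ({..<K} \<union> ?S) t"
      using fin e_mono by (intro sum.union_disjoint[symmetric]) (auto simp: strict_mono_less)
    also have "\<dots> \<le> l1_norm t" using fin by (intro asum_le_l1_norm[OF t]) simp
    finally show ?thesis using K finite_members[OF that] by (simp add: asum_embed)
  qed
  then show "\<exists>n. \<forall>F\<in>\<F>. asum (F - {..<n}) (embed t) \<le> \<epsilon>" by blast
qed

lemma partial_sum_le_norm:
  assumes "x \<in> X" shows "(\<Sum>k<m. \<bar>x (e k)\<bar>) \<le> nrm x"
proof -
  obtain F where F: "F \<in> \<F>" "e ` {..<m} \<subseteq> F" using initial_segment by blast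
  have "(\<Sum>k<m. \<bar>x (e k)\<bar>) = asum (e ` {..<m}) x"
    by (subst sum.reindex[OF inj_on_subset[OF e_inj]]) auto
  then show ?thesis using asum_subset_le_norm[OF assms F] by simp
qed

text \<open>A member meets \<open>A\<close> in a finite set, which bounds the norm by the l1 norm;
  conversely each initial segment of \<open>A\<close> is inside a member, so all partial sums of the
  l1 norm are reached.\<close>

lemma norm_embed:
  assumes t: "t \<in> l1_space" shows "nrm (embed t) = l1_norm t"
proof (rule antisym)
  show "nrm (embed t) \<le> l1_norm t"
    using asum_le_l1_norm[OF t finite_vimage_e] l1_norm_nonneg[OF t]
    by (intro norm_leI) (simp_all add: asum_embed finite_members)
  show "l1_norm t \<le> nrm (embed t)"
    using partial_sum_le_norm[OF embed_X[OF t]] by (intro l1_norm_le[OF t]) simp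
qed

lemma linear_embed: "linear_on_set Z embed"
  unfolding linear_on_set_def by (auto simp: embed_def fun_eq_iff)

lemma summable_restrict: "x \<in> X \<Longrightarrow> summable (\<lambda>k. \<bar>x (e k)\<bar>)"
  by (rule summableI_nonneg_bounded[where x = "nrm x"]) (auto intro: partial_sum_le_norm)

text \<open>A description by vanishing coordinates shows that the image is closed. Any vector of the
  space is summable along \<open>A\<close> because its partial sums there are bounded by its
  norm.\<close>

lemma embed_image: "embed ` l1_space = {x \<in> X. \<forall>i. i \<notin> A \<longrightarrow> x i = 0}"
proof
  show "embed ` l1_space \<subseteq> {x \<in> X. \<forall>i. i \<notin> A \<longrightarrow> x i = 0}"
    using embed_X by (auto simp: embed_def)
  show "{x \<in> X. \<forall>i. i \<notin> A \<longrightarrow> x i = 0} \<subseteq> embed ` l1_space"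
  proof
    fix x assume "x \<in> {x \<in> X. \<forall>i. i \<notin> A \<longrightarrow> x i = 0}"
    then have x: "x \<in> X" "\<And>i. i \<notin> A \<Longrightarrow> x i = 0" by auto
    have "x = embed (\<lambda>k. x (e k))"
    proof
      fix i show "x i = embed (\<lambda>k. x (e k)) i"
        using x(2) e_range by (auto simp: embed_def f_inv_into_f)
    qed
    moreover have "(\<lambda>k. x (e k)) \<in> l1_space" using summable_restrict[OF x(1)] by (simp add: l1_space_def)
    ultimately show "x \<in> embed ` l1_space" by blast
  qed
qed

lemma contains_l1: "contains_copy X nrm l1_space l1_norm"
  by (rule contains_copyI[OF subspace_l1 linear_embed, where c = 1 and C = 1])
    (auto simp: norm_embed embed_X intro: l1_norm_zero_iff)

text \<open>The vectors supported on \<open>A\<close> form a closed infinite-dimensional subspace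
  isometric to l1, and a copy of c0 in it would give a c0-like sequence in l1.\<close>

lemma not_c0_saturated: "\<not> c0_saturated X nrm"
proof
  assume sat: "c0_saturated X nrm"
  let ?Y = "embed ` l1_space"
  have sub: "subspace ?Y"
    unfolding embed_image using subspace_X by (auto simp: subspace_def)
  have YX: "?Y \<subseteq> X" using embed_X by blast
  have closed: "closedin (norm_topology X nrm) ?Y"
    unfolding closedin_iff
  proof (intro conjI ballI impI YX)
    fix y assume y: "y \<in> X" "\<forall>\<epsilon>>0. \<exists>v\<in>?Y. nrm (y - v) < \<epsilon>"
    have "y i = 0" if "i \<notin> A" for i
    proof -
      have "\<bar>y i\<bar> \<le> 0 + \<epsilon>" if "\<epsilon> > 0" for \<epsilon>
      proof -
        obtain v where v: "v \<in> ?Y" "nrm (y - v) < \<epsilon>" using y(2) \<open>\<epsilon> > 0\<close> by blast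
        then have "\<bar>(y - v) i\<bar> \<le> nrm (y - v)" using YX by (intro abs_le_norm X_diff y(1)) blast
        moreover have "v i = 0" using v(1) \<open>i \<notin> A\<close> by (auto simp: embed_def)
        ultimately show ?thesis using v by simp
      qed
      then have "\<bar>y i\<bar> \<le> 0" by (rule field_le_epsilon)
      then show ?thesis by simp
    qed
    then show "y \<in> ?Y" unfolding embed_image using y(1) by simp
  qed
  have inf: "infinite_dimensional ?Y"
  proof (rule infinite_dimensional_image[OF subspace_l1 linear_embed])
    fix z assume z: "z \<in> l1_space" "embed z = 0"
    then have "l1_norm z \<le> 0" using norm_embed[OF z(1)] by simp
    then show "z = 0" by (rule l1_norm_zero_iff[OF z(1)])
  qed (use unit_vec_l1 in blast)
  have "contains_copy ?Y nrm c0_space c0_norm"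
    using sat sub YX closed inf unfolding c0_saturated_def by blast
  then obtain S C D where S: "S ` c0_space \<subseteq> ?Y" "linear_on_set c0_space S"
    and C: "\<forall>z\<in>c0_space. nrm (S z) \<le> C * c0_norm z" and D: "\<forall>z\<in>c0_space. c0_norm z \<le> D * nrm (S z)"
    by (rule contains_copyD)
  define z where "z j = S (unit_vec j)" for j
  have Ssum: "S (\<Sum>j<m. t j *\<^sub>R unit_vec j) = (\<Sum>j<m. t j *\<^sub>R z j)" for t :: "nat \<Rightarrow> real" and m
    unfolding z_def by (rule linear_on_set_sum[OF S(2) subspace_c0 unit_vec_c0])
  have c0: "(\<Sum>j<m. t j *\<^sub>R unit_vec j) \<in> c0_space" for t m
    unfolding sum_unit_vec by (rule c0_space_finite_support)
  have "c0_like nrm z"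
  proof (rule c0_like_compare[OF c0_like_c0_norm, of "max C 1" "max D 1"])
    fix t :: "nat \<Rightarrow> real" and m
    let ?u = "\<Sum>j<m. t j *\<^sub>R unit_vec j" and ?z = "\<Sum>j<m. t j *\<^sub>R z j"
    have "0 \<le> c0_norm ?u" using c0_norm_ge[OF c0, of t m 0] by linarith
    have "nrm ?z \<le> C * c0_norm ?u" using C c0 Ssum by metis
    also have "\<dots> \<le> max C 1 * c0_norm ?u" using \<open>0 \<le> c0_norm ?u\<close> by (intro mult_right_mono) auto
    finally show "nrm ?z \<le> max C 1 * c0_norm ?u" .
    have "c0_norm ?u \<le> D * nrm ?z" using D c0 Ssum by metis
    also have "\<dots> \<le> max D 1 * nrm ?z" by (intro mult_right_mono) auto
    finally show "c0_norm ?u \<le> max D 1 * nrm ?z" .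
  qed auto
  moreover have "range z \<subseteq> ?Y" using S(1) unit_vec_c0 by (auto simp: z_def)
  ultimately show False
    using l1_image_no_c0[OF linear_embed, of 1 1 z] norm_embed by simp
qed

text \<open>Summation along \<open>A\<close> is a functional bounded by the norm, and it takes the
  value 1 at every unit vector with index in \<open>A\<close>. Such vectors occur in every tail,
  since \<open>n \<le> e n\<close>.\<close>

lemma not_shrinking: "\<not> shrinking_basis X nrm unit_vec"
proof
  assume shr: "shrinking_basis X nrm unit_vec"
  define f where "f x = (\<Sum>k. x (e k))" for x :: "nat \<Rightarrow> real"
  have sm: "summable (\<lambda>k. x (e k))" if "x \<in> X" for x
    using summable_restrict[OF that] by (rule summable_rabs_cancel)
  have f_le: "\<bar>f x\<bar> \<le> nrm x" if "x \<in> X" for x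
  proof -
    have "\<bar>f x\<bar> \<le> (\<Sum>k. \<bar>x (e k)\<bar>)" unfolding f_def by (rule summable_rabs[OF summable_restrict[OF that]])
    also have "\<dots> \<le> nrm x" using summable_restrict[OF that] partial_sum_le_norm[OF that] by (rule suminf_le_const)
    finally show ?thesis .
  qed
  have "linear_on_set X f"
    unfolding linear_on_set_def f_def using sm by (auto simp: suminf_add suminf_mult)
  then have "bounded_linear_on_set X nrm abs f"
    unfolding bounded_linear_on_set_def using f_le by (metis mult_1)
  then have lim: "(\<lambda>n. functional_norm (closed_span X nrm (unit_vec ` {n..})) nrm f) \<longlonglongrightarrow> 0"
    using shr unfolding shrinking_basis_def by blast
  have "1 \<le> functional_norm (closed_span X nrm (unit_vec ` {n..})) nrm f" for n
  proof -
    let ?V = "{x \<in> closed_span X nrm (unit_vec ` {n..}). nrm x \<le> 1}"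
    have "n \<le> e n" using seq_suble[OF e_mono] .
    then have "unit_vec (e n) \<in> span (unit_vec ` {n..})" by (intro span_base) simp
    then have "unit_vec (e n) \<in> closed_span X nrm (unit_vec ` {n..})"
      using subset_closed_span[of "unit_vec ` {n..}"] unit_vec_X by blast
    moreover have "nrm (unit_vec (e n)) \<le> 1"
    proof (rule norm_leI)
      fix F assume "F \<in> \<F>"
      then show "asum F (unit_vec (e n)) \<le> 1"
        using finite_members by (simp add: unit_vec_def if_distrib cong: if_cong)
    qed simp
    ultimately have V: "unit_vec (e n) \<in> ?V" by simp
    have "\<bar>f x\<bar> \<le> 1" if "x \<in> ?V" for x
    proof -
      have "x \<in> X" using that closed_span_tail_subset[of n] by blast
      then show ?thesis using f_le[of x] that by simp
    qed
    then have "\<bar>f (unit_vec (e n))\<bar> \<le> functional_norm (closed_span X nrm (unit_vec ` {n..})) nrm f"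
      unfolding functional_norm_def by (intro cSUP_upper V bdd_aboveI[of _ 1]) blast
    moreover have "f (unit_vec (e n)) = 1"
    proof -
      have "unit_vec (e n) (e k) = (if k = n then 1 else 0)" for k
        using e_inj by (auto simp: unit_vec_def inj_eq)
      then show ?thesis unfolding f_def using suminf_finite[of "{n}" "\<lambda>k. unit_vec (e n) (e k)"] by simp
    qed
    ultimately show ?thesis by simp
  qed
  then have "(1::real) \<le> 0" by (intro tendsto_lowerbound[OF lim]) auto
  then show False by simp
qed

end

section \<open>Ideals\<close>

context cover_family
begin

lemma family_ideal_iff: "A \<in> family_ideal \<F> \<tau> \<longleftrightarrow> coord_proj A \<tau> \<in> X"
proof -
  have "coord_proj (A - {..<n}) \<tau> = coord_proj (UNIV - {..<n}) (coord_proj A \<tau>)" for n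
    by (auto simp: fun_eq_iff)
  then show ?thesis by (simp add: family_ideal_def submeasure_def X_space_def)
qed

lemma coord_proj_finite_X:
  assumes "finite A" shows "coord_proj A \<tau> \<in> X"
proof -
  obtain k where "A \<subseteq> {..<k}" using assms finite_nat_iff_bounded by blast
  then show ?thesis by (intro X_finite_support[of k]) auto
qed

text \<open>In terms of ideals: closure under subsets and under finite modifications.\<close>

lemma coord_proj_X_subset_Un:
  assumes "coord_proj A \<tau> \<in> X" "finite G" "B \<subseteq> A \<union> G"
  shows "coord_proj B \<tau> \<in> X"
proof (rule X_mono)
  show "(\<lambda>i. \<bar>coord_proj A \<tau> i\<bar>) + (\<lambda>i. \<bar>coord_proj G \<tau> i\<bar>) \<in> X"
    by (intro X_add X_mono[OF assms(1)] X_mono[OF coord_proj_finite_X[OF assms(2), of \<tau>]]) simp_all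
  show "\<bar>coord_proj B \<tau> i\<bar> \<le> \<bar>((\<lambda>i. \<bar>coord_proj A \<tau> i\<bar>) + (\<lambda>i. \<bar>coord_proj G \<tau> i\<bar>)) i\<bar>" for i
    using assms(3) by auto
qed

text \<open>Blocks are single coordinates and multipliers are 0 or 1, so the maximal sequence is the
  restriction of \<open>\<tau>\<close> to a set \<open>A\<close>. Were \<open>A\<close> in the
  ideal, every late \<open>n\<close> outside \<open>A\<close> would satisfy
  \<open>\<tau> n > \<eta>\<close>. A set meeting \<open>{n. \<tau> n > \<eta>}\<close> in a finite
  set would then be almost contained in \<open>A\<close>, and the ideal would be a trivial
  modification of Fin.\<close>

lemma small_sets_outside_ideal:
  assumes precompact: "precompact_family \<F>" and \<tau>: "\<And>n. \<tau> n > 0"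
    and nontrivial: "\<not> trivial_modification_of_Fin (family_ideal \<F> \<tau>)" and "\<epsilon> > 0"
  obtains A where "A \<notin> family_ideal \<F> \<tau>" "\<forall>F\<in>\<F>. asum F (coord_proj A \<tau>) \<le> \<epsilon>"
proof -
  obtain a :: "nat \<Rightarrow> real" where a: "\<forall>n. a n \<in> {0, 1}" and le: "\<forall>F\<in>\<F>. asum F (\<lambda>i. a i * \<tau> i) \<le> \<epsilon>"
    and max: "(\<lambda>i. a i * \<tau> i) \<in> X \<longrightarrow> (\<exists>\<eta>>0. \<exists>K. \<forall>n\<ge>K. \<forall>d\<in>{0, 1}. d > a n \<longrightarrow>
      (\<exists>F\<in>\<F>. asum F (\<lambda>i. if i = n then (d - a n) * \<tau> i else 0) > \<eta>))"
  proof (rule maximal_multiplier[where D = "{0, 1}" and r = \<epsilon> and idx = "\<lambda>i. i" and \<beta> = \<tau>])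
    show "\<exists>i. i = n \<and> \<tau> i \<noteq> 0" for n using \<tau>[of n] by simp
  qed (use precompact \<open>\<epsilon> > 0\<close> in auto)
  define A where "A = {n. a n = 1}"
  have A: "a i * \<tau> i = coord_proj A \<tau> i" for i
    using a[rule_format, of i] by (auto simp: A_def)
  have "A \<notin> family_ideal \<F> \<tau>"
  proof
    assume "A \<in> family_ideal \<F> \<tau>"
    then have AX: "coord_proj A \<tau> \<in> X" by (simp add: family_ideal_iff)
    then obtain \<eta> K where \<eta>: "\<eta> > 0" and K: "\<forall>n\<ge>K. \<forall>d\<in>{0, 1}. d > a n \<longrightarrow>
      (\<exists>F\<in>\<F>. asum F (\<lambda>i. if i = n then (d - a n) * \<tau> i else 0) > \<eta>)"
      using max unfolding ext[OF A] by blast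
    have large: "\<tau> n > \<eta>" if n: "n \<ge> K" "n \<notin> A" for n
    proof -
      have an: "a n = 0" using a n(2) by (auto simp: A_def)
      then have "\<exists>F\<in>\<F>. asum F (\<lambda>i. if i = n then (1 - a n) * \<tau> i else 0) > \<eta>"
        using K n(1) by simp
      then obtain F where F: "F \<in> \<F>" "asum F (\<lambda>i. if i = n then (1 - a n) * \<tau> i else 0) > \<eta>" by blast
      have "asum F (\<lambda>i. if i = n then (1 - a n) * \<tau> i else 0) = (\<Sum>i\<in>F. if i = n then \<tau> n else 0)"
        using an \<tau>[of n] by (intro sum.cong) auto
      also have "\<dots> \<le> \<tau> n" using finite_members[OF F(1)] \<tau>[of n] by simp
      finally show ?thesis using F(2) by simp
    qed
    have "family_ideal \<F> \<tau> = {B. finite (B \<inter> {n. \<tau> n > \<eta>})}"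
    proof (intro set_eqI iffI)
      fix B assume "B \<in> family_ideal \<F> \<tau>"
      then have "coord_proj B \<tau> \<in> X" by (simp add: family_ideal_iff)
      then obtain N where N: "\<forall>F\<in>\<F>. asum (F - {..<N}) (coord_proj B \<tau>) \<le> \<eta>"
        using \<eta> unfolding X_iff by meson
      have "i < N" if i: "i \<in> B" "\<tau> i > \<eta>" for i
      proof (rule ccontr)
        assume "\<not> i < N"
        have "i \<in> \<Union>\<F>" by (simp add: cover)
        then obtain F where F: "F \<in> \<F>" "i \<in> F" by (rule UnionE)
        have "asum {i} (coord_proj B \<tau>) \<le> asum (F - {..<N}) (coord_proj B \<tau>)"
          using F finite_members \<open>\<not> i < N\<close> by (intro sum_mono2) auto
        then show False using N F(1) i by fastforce
      qed
      then have "B \<inter> {n. \<tau> n > \<eta>} \<subseteq> {..<N}" by auto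
      then show "B \<in> {B. finite (B \<inter> {n. \<tau> n > \<eta>})}" using finite_subset by blast
    next
      fix B assume "B \<in> {B. finite (B \<inter> {n. \<tau> n > \<eta>})}"
      then have "finite (B \<inter> {n. \<tau> n > \<eta>} \<union> {..<K})" by simp
      moreover have "B \<subseteq> A \<union> (B \<inter> {n. \<tau> n > \<eta>} \<union> {..<K})"
        using large by (auto simp: not_less)
      ultimately have "coord_proj B \<tau> \<in> X" by (rule coord_proj_X_subset_Un[OF AX])
      then show "B \<in> family_ideal \<F> \<tau>" by (simp add: family_ideal_iff)
    qed
    then show False using nontrivial unfolding trivial_modification_of_Fin_def by blast
  qed
  moreover have "\<forall>F\<in>\<F>. asum F (coord_proj A \<tau>) \<le> \<epsilon>" using le by (simp only: A)
  ultimately show thesis by (rule that)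
qed

text \<open>A Baire category argument by hand: arbitrarily small sets outside the ideal are glued to a
  member of the ideal that escapes each of the given closed sets.\<close>

lemma precompact_imp_not_F_sigma:
  assumes precompact: "precompact_family \<F>" and \<tau>: "\<And>n. \<tau> n > 0"
    and nontrivial: "\<not> trivial_modification_of_Fin (family_ideal \<F> \<tau>)"
  shows "\<not> F_sigma (family_ideal \<F> \<tau>)"
proof
  let ?I = "family_ideal \<F> \<tau>"
  assume "F_sigma ?I"
  then have "\<exists>C. (\<forall>k. closedin euclidean (C k)) \<and> (\<forall>k. C k \<subseteq> C (Suc k)) \<and> \<Union> (range C) = chi ` ?I"
    unfolding F_sigma_def fsigma_in_ascending .
  then obtain C :: "nat \<Rightarrow> (nat \<Rightarrow> bool) set" where C: "\<And>k. closed (C k)" "\<Union> (range C) = chi ` ?I"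
    by auto
  have chi: "S \<in> ?I" if "chi S \<in> C k" for S k
  proof -
    have "chi S \<in> chi ` ?I" using that C(2) by blast
    then obtain S' where "chi S = chi S'" "S' \<in> ?I" by (rule imageE)
    then show ?thesis by (simp add: chi_def fun_eq_iff set_eq_iff[symmetric])
  qed
  \<comment> \<open>One stage of a fusion. The additions are small enough to be summed, which keeps
    the union in the ideal, and escape from \<open>C k\<close> is decided by the initial segment
    below \<open>n'\<close>, which later stages preserve.\<close>
  define P where "P k B n B' n' \<longleftrightarrow> n < n' \<and> B' \<subseteq> {..<n'} \<and> B' \<inter> {..<n} = B \<and>
      (\<forall>F\<in>\<F>. asum F (coord_proj (B' - B) \<tau>) \<le> (1/2) ^ k) \<and>
      (\<forall>G. G \<inter> {..<n'} = B' \<longrightarrow> chi G \<notin> C k)" for k n n' :: nat and B B'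
  have step: "\<exists>B' n'. P k B n B' n'" if B: "B \<subseteq> {..<n}" for k n B
  proof -
    obtain A where A: "A \<notin> ?I" "\<forall>F\<in>\<F>. asum F (coord_proj A \<tau>) \<le> (1/2) ^ k"
      by (rule small_sets_outside_ideal[OF precompact \<tau> nontrivial, of "(1/2) ^ k"]) auto
    \<comment> \<open>A finite change does not bring \<open>A\<close> into the ideal, so
      \<open>S\<close> prolongs \<open>B\<close> and stays outside \<open>C k\<close>. Closedness of
      \<open>C k\<close> lets a finite part of \<open>S\<close> witness this.\<close>
    define S where "S = B \<union> (A - {..<n})"
    have "S \<notin> ?I"
    proof
      assume "S \<in> ?I"
      then have "coord_proj S \<tau> \<in> X" by (simp only: family_ideal_iff)
      moreover have "A \<subseteq> S \<union> {..<n}" by (auto simp: S_def)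
      ultimately have "coord_proj A \<tau> \<in> X" by (rule coord_proj_X_subset_Un[OF _ finite_lessThan])
      then show False using A(1) by (simp add: family_ideal_iff)
    qed
    then have "chi S \<notin> C k" using chi[of S k] by (rule contrapos_nn)
    then obtain n0 where n0: "\<forall>G. G \<inter> {..<n0} = S \<inter> {..<n0} \<longrightarrow> chi G \<notin> C k"
      by (rule closed_chi_separation[OF C(1)])
    let ?n = "max (Suc n) n0"
    have "P k B n (S \<inter> {..<?n}) ?n"
      unfolding P_def
    proof (intro conjI allI impI ballI)
      show "S \<inter> {..<?n} \<inter> {..<n} = B" using B by (auto simp: S_def)
      fix F assume "F \<in> \<F>"
      have "asum F (coord_proj (S \<inter> {..<?n} - B) \<tau>) \<le> asum F (coord_proj A \<tau>)"
        by (rule sum_mono) (auto simp: S_def)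
      then show "asum F (coord_proj (S \<inter> {..<?n} - B) \<tau>) \<le> (1/2) ^ k" using A(2) \<open>F \<in> \<F>\<close> by fastforce
    next
      fix G assume G: "G \<inter> {..<?n} = S \<inter> {..<?n}"
      have "G \<inter> {..<n0} = G \<inter> {..<?n} \<inter> {..<n0}" by auto
      also have "\<dots> = S \<inter> {..<n0}" unfolding G by auto
      finally show "chi G \<notin> C k" using n0 by simp
    qed auto
    then show ?thesis by blast
  qed
  have "\<exists>h. \<forall>k. (case h k of (B, n) \<Rightarrow> B \<subseteq> {..<n}) \<and>
      (case h k of (B, n) \<Rightarrow> case h (Suc k) of (B', n') \<Rightarrow> P k B n B' n')"
  proof (rule dependent_nat_choice)
    show "\<exists>x. case x of (B, n) \<Rightarrow> B \<subseteq> {..<n :: nat}" by (rule exI[of _ "({}, 0)"]) simp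
    fix x :: "nat set \<times> nat" and k assume "case x of (B, n) \<Rightarrow> B \<subseteq> {..<n}"
    then have "fst x \<subseteq> {..<snd x}" by (simp add: case_prod_beta)
    then have "\<exists>B' n'. P k (fst x) (snd x) B' n'" by (rule step)
    then obtain B' n' where "P k (fst x) (snd x) B' n'" by (elim exE)
    then show "\<exists>y. (case y of (B, n) \<Rightarrow> B \<subseteq> {..<n}) \<and>
        (case x of (B, n) \<Rightarrow> case y of (B', n') \<Rightarrow> P k B n B' n')"
      by (intro exI[of _ "(B', n')"]) (auto simp: P_def case_prod_beta)
  qed
  then obtain h where h: "\<And>k. P k (fst (h k)) (snd (h k)) (fst (h (Suc k))) (snd (h (Suc k)))"
    and h0: "\<And>k. fst (h k) \<subseteq> {..<snd (h k)}"
    by (auto simp: case_prod_beta)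
  define B where "B k = fst (h k)" for k
  define n where "n k = snd (h k)" for k
  have P: "P k (B k) (n k) (B (Suc k)) (n (Suc k))" for k using h by (simp add: B_def n_def)
  have Bn: "B k \<subseteq> {..<n k}" for k using h0 by (simp add: B_def n_def)
  have mono: "strict_mono n" using P by (simp add: strict_mono_Suc_iff P_def)
  have BSuc: "B (Suc k) \<inter> {..<n k} = B k" for k using P by (simp add: P_def)
  have B_int: "B l \<inter> {..<n k} = B k" if "k \<le> l" for k l
    using that
  proof (induction l rule: dec_induct)
    case base then show ?case using Bn[of k] by blast
  next
    case (step l)
    have "n k \<le> n l" using step.hyps mono by (simp add: strict_mono_less_eq)
    then have "B (Suc l) \<inter> {..<n k} = (B (Suc l) \<inter> {..<n l}) \<inter> {..<n k}" by auto
    then show ?case using step.IH BSuc by simp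
  qed
  define G where "G = (\<Union>k. B k)"
  have G: "G \<inter> {..<n k} = B k" for k
  proof
    show "G \<inter> {..<n k} \<subseteq> B k"
    proof
      fix i assume i: "i \<in> G \<inter> {..<n k}"
      then obtain l where l: "i \<in> B l" by (auto simp: G_def)
      have "B l \<subseteq> B (max k l)" using B_int[of l "max k l"] by auto
      then have "i \<in> B (max k l) \<inter> {..<n k}" using l i by auto
      then show "i \<in> B k" using B_int[of k "max k l"] by simp
    qed
    show "B k \<subseteq> G \<inter> {..<n k}" using Bn by (auto simp: G_def)
  qed
  have "chi G \<notin> C k" for k using P[of k] G[of "Suc k"] by (simp add: P_def)
  moreover have "G \<in> ?I"
    unfolding family_ideal_iff
  proof (rule X_closed)
    fix \<epsilon> :: real assume "\<epsilon> > 0"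
    obtain k where k: "(1/2::real) ^ k < \<epsilon>/2"
      using real_arch_pow_inv[of "\<epsilon>/2" "1/2"] \<open>\<epsilon> > 0\<close> by auto
    have "asum F (coord_proj G \<tau> - coord_proj (B k) \<tau>) \<le> \<epsilon>" if F: "F \<in> \<F>" for F
    proof -
      \<comment> \<open>The bound is the geometric sum of \<open>(1/2) ^ j\<close> over
        \<open>j\<close> from \<open>k\<close> to \<open>l - 1\<close>, one term for each
        stage.\<close>
      have le: "asum F (coord_proj (B l - B k) \<tau>) \<le> 2 * (1/2) ^ k - 2 * (1/2) ^ l" if "k \<le> l" for l
        using that
      proof (induction l rule: dec_induct)
        case base then show ?case by simp
      next
        case (step l)
        have "asum F (coord_proj (B (Suc l) - B k) \<tau>) \<le>
            asum F (coord_proj (B (Suc l) - B l) \<tau>) + asum F (coord_proj (B l - B k) \<tau>)"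
          unfolding sum.distrib[symmetric] by (rule sum_mono) auto
        also have "asum F (coord_proj (B (Suc l) - B l) \<tau>) \<le> (1/2) ^ l"
          using P[of l] F unfolding P_def by blast
        finally show ?case using step.IH by simp
      qed
      obtain m where m: "F \<subseteq> {..<m}" using finite_members[OF F] finite_nat_iff_bounded by blast
      let ?l = "max k m"
      have "m \<le> n ?l" using seq_suble[OF mono, of ?l] by simp
      have "asum F (coord_proj G \<tau> - coord_proj (B k) \<tau>) = asum F (coord_proj (B ?l - B k) \<tau>)"
      proof (rule sum.cong)
        fix i assume "i \<in> F"
        then have "i < n ?l" using m \<open>m \<le> n ?l\<close> by auto
        then have "i \<in> G \<longleftrightarrow> i \<in> B ?l" using G[of ?l] by blast
        moreover have "i \<in> B k \<Longrightarrow> i \<in> B ?l" using B_int[of k ?l] by auto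
        ultimately show "\<bar>(coord_proj G \<tau> - coord_proj (B k) \<tau>) i\<bar> = \<bar>coord_proj (B ?l - B k) \<tau> i\<bar>"
          by auto
      qed simp
      also have "\<dots> \<le> 2 * (1/2) ^ k - 2 * (1/2) ^ ?l" by (rule le) simp
      also have "\<dots> \<le> 2 * (1/2) ^ k" by simp
      finally show ?thesis using k by simp
    qed
    moreover have "coord_proj (B k) \<tau> \<in> X"
      using Bn finite_subset by (intro coord_proj_finite_X) blast
    ultimately show "\<exists>y\<in>X. \<forall>F\<in>\<F>. asum F (coord_proj G \<tau> - y) \<le> \<epsilon>" by blast
  qed
  ultimately show False using C(2) by blast
qed

text \<open>The sum over a member never exceeds the l1 norm, so l1 tails control the tails
  here.\<close>

lemma l1_subset_X:
  assumes t: "t \<in> l1_space" shows "t \<in> X"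
  unfolding X_iff
proof (intro allI impI)
  fix \<epsilon> :: real assume "\<epsilon> > 0"
  then obtain K where K: "l1_norm t \<le> asum {..<K} t + \<epsilon>" using l1_tail[OF t] by blast
  have "asum (F - {..<K}) t \<le> \<epsilon>" if "F \<in> \<F>" for F
  proof -
    have fin: "finite F" using finite_members[OF that] .
    have "asum {..<K} t + asum (F - {..<K}) t = asum ({..<K} \<union> (F - {..<K})) t"
      using fin by (intro sum.union_disjoint[symmetric]) auto
    also have "\<dots> \<le> l1_norm t" using fin by (intro asum_le_l1_norm[OF t]) simp
    finally show ?thesis using K by simp
  qed
  then show "\<exists>n. \<forall>F\<in>\<F>. asum (F - {..<n}) t \<le> \<epsilon>" by blast
qed

end

section \<open>The summable ideal transported to the limit set\<close>

context infinite_limit_set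
begin

text \<open>Off \<open>A\<close> the weights are geometric, so everything outside \<open>A\<close>
  belongs to the ideal and only the trace of a set on \<open>A\<close> matters.\<close>

definition weight :: "nat \<Rightarrow> real" where
  "weight i = (if i \<in> A then 1 / real (Suc (inv e i)) else (1/2) ^ i)"

lemma weight_pos: "weight i > 0"
  by (simp add: weight_def)

abbreviation harmonic_part :: "nat set \<Rightarrow> nat \<Rightarrow> real" where
  "harmonic_part B \<equiv> \<lambda>k. if e k \<in> B then 1 / real (Suc k) else 0"

text \<open>The restricted weight splits into a part on \<open>A\<close>, where membership in the
  space means absolute summability, and a part off \<open>A\<close> dominated by a geometric
  series.\<close>

lemma weight_ideal_iff:
  "B \<in> family_ideal \<F> weight \<longleftrightarrow> summable (harmonic_part B)"
proof -
  have eA: "e k \<in> A" for k using e_range by blast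
  have we: "weight (e k) = 1 / real (Suc k)" for k using eA e_inj by (simp add: weight_def)
  have dec: "coord_proj B weight = embed (harmonic_part B) + coord_proj (B - A) weight"
  proof
    fix i show "coord_proj B weight i = (embed (harmonic_part B) + coord_proj (B - A) weight) i"
    proof (cases "i \<in> A")
      case True
      then obtain k where "i = e k" using e_range by blast
      then show ?thesis using eA we by simp
    qed (simp add: embed_def)
  qed
  show ?thesis
  proof
    assume "B \<in> family_ideal \<F> weight"
    then have "coord_proj B weight \<in> X" by (simp add: family_ideal_iff)
    then have "summable (\<lambda>k. \<bar>coord_proj B weight (e k)\<bar>)" by (rule summable_restrict)
    moreover have "(\<lambda>k. \<bar>coord_proj B weight (e k)\<bar>) = harmonic_part B"
      by (auto simp: fun_eq_iff we)
    ultimately show "summable (harmonic_part B)" by simp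
  next
    assume sm: "summable (harmonic_part B)"
    have "\<bar>harmonic_part B k\<bar> = harmonic_part B k" for k by simp
    then have "harmonic_part B \<in> l1_space" using sm by (simp only: l1_space_def mem_Collect_eq)
    then have "embed (harmonic_part B) \<in> X" by (rule embed_X)
    moreover have "summable (\<lambda>k. \<bar>coord_proj (B - A) weight k\<bar>)"
      by (rule summable_comparison_test'[where g = "\<lambda>k. (1/2) ^ k" and N = 0])
        (auto simp: weight_def)
    then have "coord_proj (B - A) weight \<in> X" by (intro l1_subset_X) (simp only: l1_space_def mem_Collect_eq)
    ultimately show "B \<in> family_ideal \<F> weight" unfolding family_ideal_iff dec by (rule X_add)
  qed
qed

text \<open>Summability of nonnegative terms means that all partial sums are bounded by some natural
  number \<open>m\<close>. Each such bound involves finitely many coordinates and is closed, so for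
  fixed \<open>m\<close> the condition is closed.\<close>

lemma weight_ideal_F_sigma: "F_sigma (family_ideal \<F> weight)"
proof -
  define C :: "nat \<Rightarrow> (nat \<Rightarrow> bool) set" where
    "C m = {f. \<forall>n. (\<Sum>k<n. if f (e k) then 1 / real (Suc k) else 0) \<le> real m}" for m
  have "closed (C m)" for m
  proof -
    have "continuous_on UNIV (\<lambda>f :: nat \<Rightarrow> bool. if f (e k) then 1 / real (Suc k) else 0)" for k
      by (rule continuous_on_compose2[of UNIV "\<lambda>b. if b then 1 / real (Suc k) else 0" UNIV "\<lambda>f. f (e k)"])
        (simp_all add: continuous_on_discrete)
    then show ?thesis
      unfolding C_def by (intro closed_Collect_all closed_Collect_le continuous_on_sum continuous_on_const)
  qed
  moreover have "C m \<subseteq> C (Suc m)" for m by (auto simp: C_def intro: order_trans)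
  moreover have "\<Union> (range C) = chi ` family_ideal \<F> weight"
  proof (intro set_eqI iffI)
    fix f assume "f \<in> \<Union> (range C)"
    then obtain m where m: "f \<in> C m" by blast
    have "summable (harmonic_part {i. f i})"
      by (rule summableI_nonneg_bounded[where x = "real m"]) (use m in \<open>auto simp: C_def\<close>)
    then have "{i. f i} \<in> family_ideal \<F> weight" by (simp add: weight_ideal_iff)
    moreover have "f = chi {i. f i}" by (simp add: chi_def)
    ultimately show "f \<in> chi ` family_ideal \<F> weight" by blast
  next
    fix f assume "f \<in> chi ` family_ideal \<F> weight"
    then obtain B where B: "f = chi B" "summable (harmonic_part B)" using weight_ideal_iff by blast
    obtain m where "(\<Sum>k. harmonic_part B k) < real m" using reals_Archimedean2 by blast
    moreover have "(\<Sum>k<n. harmonic_part B k) \<le> (\<Sum>k. harmonic_part B k)" for n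
      by (rule sum_le_suminf[OF B(2)]) auto
    ultimately have "f \<in> C m" unfolding C_def B(1) chi_def by (auto intro: order_trans less_imp_le)
    then show "f \<in> \<Union> (range C)" by blast
  qed
  ultimately show ?thesis unfolding F_sigma_def fsigma_in_ascending by (metis closed_closedin)
qed

text \<open>If the ideal were Fin on \<open>S\<close>, then \<open>A \<inter> S\<close> would be
  infinite by divergence of the harmonic series. A sparse infinite subset of it would nevertheless
  have finite weight and belong to the ideal.\<close>

lemma weight_ideal_nontrivial: "\<not> trivial_modification_of_Fin (family_ideal \<F> weight)"
proof
  assume "trivial_modification_of_Fin (family_ideal \<F> weight)"
  then obtain S where ideal: "family_ideal \<F> weight = {B. finite (B \<inter> S)}"
    unfolding trivial_modification_of_Fin_def by (rule exE)
  have S: "finite (B \<inter> S) \<longleftrightarrow> summable (harmonic_part B)" for B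
    using weight_ideal_iff[of B] unfolding ideal by simp
  have eA: "e k \<in> A" for k using e_range by blast
  have "harmonic_part A = (\<lambda>k. inverse (real (Suc k)))" using eA by (simp add: inverse_eq_divide)
  moreover have "\<not> summable (\<lambda>k. inverse (real (Suc k)))"
    by (subst summable_Suc_iff) (rule not_summable_harmonic)
  ultimately have "infinite (A \<inter> S)" using S by simp
  moreover have "A \<inter> S = e ` {k. e k \<in> S}" using e_range by auto
  ultimately have K: "infinite {k. e k \<in> S}" by (metis finite_imageI)
  \<comment> \<open>The element with number \<open>2 ^ j\<close> is at least \<open>2 ^ j\<close>,
    so its harmonic weight is at most \<open>(1/2) ^ j\<close>.\<close>
  define l where "l j = enumerate {k. e k \<in> S} (2 ^ j)" for j
  have l: "strict_mono l"
    using strict_mono_enumerate[OF K] by (auto simp: strict_mono_def l_def)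
  have lS: "e (l j) \<in> S" for j using enumerate_in_set[OF K] by (simp add: l_def)
  let ?B = "e ` range l"
  have eB: "e k \<in> ?B \<longleftrightarrow> k \<in> range l" for k using e_inj by (auto simp: inj_eq)
  have "summable (\<lambda>j. harmonic_part ?B (l j))"
  proof (rule summable_comparison_test'[where g = "\<lambda>j. (1/2) ^ j" and N = 0])
    fix j
    have "2 ^ j \<le> l j" using le_enumerate[OF K] by (simp add: l_def)
    then have "real (2 ^ j) \<le> real (Suc (l j))" using of_nat_mono le_SucI by blast
    then have "1 / real (Suc (l j)) \<le> 1 / real (2 ^ j)" by (intro divide_left_mono) auto
    then show "norm (harmonic_part ?B (l j)) \<le> (1/2) ^ j" by (simp add: power_one_over)
  qed simp
  then have "summable (harmonic_part ?B)"
    using eB by (subst (asm) summable_mono_reindex[OF l]) auto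
  then have "finite (?B \<inter> S)" using S by simp
  moreover have "?B \<inter> S = range (\<lambda>j. e (l j))" using lS by auto
  moreover have "inj (\<lambda>j. e (l j))"
    using inj_compose[OF e_inj strict_mono_imp_inj_on[OF l, of UNIV]] by (simp add: o_def)
  ultimately show False by (metis finite_imageD infinite_UNIV_nat)
qed

end

theorem theorem6p3:
  fixes \<F> :: "nat set set"
  assumes finite_members: "\<And>F. F \<in> \<F> \<Longrightarrow> finite F"
    and cover: "\<Union>\<F> = (UNIV :: nat set)"
  shows "(precompact_family \<F> \<longleftrightarrow> c0_saturated (X_space \<F>) (X_norm \<F>)) \<and>
    (precompact_family \<F> \<longleftrightarrow>
       \<not> contains_copy (X_space \<F>) (X_norm \<F>) l1_space l1_norm) \<and>
    (precompact_family \<F> \<longleftrightarrow> shrinking_basis (X_space \<F>) (X_norm \<F>) unit_vec) \<and>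
    (precompact_family \<F> \<longleftrightarrow>
       (\<forall>\<I>. is_family_ideal \<F> \<I> \<and> \<not> trivial_modification_of_Fin \<I> \<longrightarrow> \<not> F_sigma \<I>))"
proof -
  interpret cover_family \<F> using assms by unfold_locales
  show ?thesis
  proof (cases "precompact_family \<F>")
    case True
    then show ?thesis
      using precompact_imp_c0_saturated precompact_imp_no_l1 precompact_imp_shrinking
        precompact_imp_not_F_sigma unfolding is_family_ideal_def by blast
  next
    case False
    then obtain A where "infinite A" "\<forall>n. \<exists>F\<in>\<F>. F \<inter> {..<n} = A \<inter> {..<n}"
      unfolding precompact_iff by blast
    then interpret infinite_limit_set \<F> A by unfold_locales auto
    have "is_family_ideal \<F> (family_ideal \<F> weight)"
      unfolding is_family_ideal_def using weight_pos by blast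
    then show ?thesis
      using False not_c0_saturated contains_l1 not_shrinking weight_ideal_nontrivial
        weight_ideal_F_sigma by blast
  qed
qed

end
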